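(* Let $n\ge2$, let $\lambda$ be a dominant integral weight of $\mathfrak{sl}_n$ and let $\lambda^*$ be the highest weight of the dual representation of $V(\lambda)$. Let $$F=\sum_{P\in\mathrm{GT}(\lambda)}\frac{(-1)^{\ell(P)}}{\|P\|\,\|P^*\|}\;e_P\otimes e_{P^*}.$$ Then $F$ is an $\mathrm{SL}_n$-invariant vector in $V(\lambda)\otimes V(\lambda^* )$.
   Context: Everything is over $\mathbb{C}$; $V(\lambda)$ is the irreducible $\mathrm{SL}_n$-representation with highest weight $\lambda$. **Partition and patterns.** For $\lambda=\sum_{i=1}^{n-1}a_i\omega_i$ ($\omega_i$ the fundamental dominant weights), the partition $\pi(\lambda)$ has parts $\pi_i=\sum_{j=i}^{n-1}a_j$ for $1\le i\le n-1$ and $\pi_n=0$. A Gelfand–Tsetlin pattern of shape $\pi(\lambda)$ is a triangular array $P=(x_{k,i})_{1\le i\le k\le n}$ of nonnegative integers with top row $x_{n,i}=\pi_i$ and $x_{k,i}\ge x_{k-1,i}\ge x_{k,i+1}$ for $1\le i\le k-1$, $2\le k\le n$. $\mathrm{GT}(\lambda)$ is the set of all such patterns. **Gelfand–Tsetlin basis.** Write $l_{k,i}=x_{k,i}-i+1$. $P\pm\delta_{k,i}$ is the array obtained from $P$ by replacing $x_{k,i}$ by $x_{k,i}\pm1$. The Gelfand–Tsetlin basis $\{e_P: P\in\mathrm{GT}(\lambda)\}$ of $V(\lambda)$ is the basis (unique up to a common scalar) of weight vectors on which the root vectors $X_{\alpha_k}=E_{k,k+1}$, $Y_{\alpha_k}=E_{k+1,k}$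 ($1\le k\le n-1$) act by $$X_{\alpha_k}e_P=\sum_{i=1}^k\frac{-\prod_{q=1}^{k+1}(l_{k,i}-l_{k+1,q})}{\prod_{q\ne i,\,1\le q\le k}(l_{k,i}-l_{k,q})}e_{P+\delta_{k,i}},\qquad Y_{\alpha_k}e_P=\sum_{i=1}^k\frac{\prod_{q=1}^{k-1}(l_{k,i}-l_{k-1,q})}{\prod_{q\ne i,\,1\le q\le k}(l_{k,i}-l_{k,q})}e_{P-\delta_{k,i}},$$ with $e_Q=0$ if $Q$ is not a pattern. The same convention is used for $V(\lambda^* )$. **Dual pattern.** For $P\in\mathrm{GT}(\lambda)$, $P^*=(y_{i,j})\in\mathrm{GT}(\lambda^* )$ is given by $y_{i,j}=x_{n,1}-x_{i,i+1-j}$. **Level.** The weight of $P$ is $\mathrm{wt}(P)=\sum_{i=1}^{n-1}\left(-\sum_{j=1}^{i-1}x_{i-1,j}+2\sum_{j=1}^{i}x_{i,j}-\sum_{j=1}^{i+1}x_{i+1,j}\right)\omega_i$. Writing $\mathrm{wt}(P)=\lambda-\sum_{i=1}^{n-1}k_i\alpha_i$ with $\alpha_i$ the simple roots, $\ell(P)=\sum_i k_i$. **Norm.** $\|P\|$ is the positive square root of $$\|P\|^2=\prod_{t=2}^n\ \prod_{1\le p\le q<t}\frac{(l_{t,p}-l_{t-1,q})!}{(l_{t-1,p}-l_{t-1,q})!}\ \prod_{1\le p<q\le t}\frac{(l_{t,p}-l_{t,q}-1)!}{(l_{t-1,p}-l_{t,q}-1)!}.$$ (The last product only involves entries $l_{t-1,p}$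 with $p\le t-1$.) $\|P^*\|$ is defined by the same formula applied to $P^*$. *)

theory Defs
  imports
    "HOL-Analysis.Derivative"
    "Jordan_Normal_Form.VS_Connect"
begin

text \<open>
  Conventions.  A finite-dimensional complex vector space is \<open>\<complex>\<^sup>N\<close>, with an arbitrary \<open>N\<close>, i.e.
  \<^term>\<open>carrier_vec N :: complex vec set\<close>, and a representation of \<open>SL\<^sub>n\<close> on it is a
  matrix-valued function on \<open>SL\<^sub>n\<close>.  The indices of weights, patterns and root vectors start
  at 1, as in the mathematical notation, whereas those of matrices and vectors start at 0.
\<close>

section \<open>Representations of the special linear group\<close>

definition SL :: "nat \<Rightarrow> complex mat monoid" where
  "SL n = \<lparr>carrier = {g \<in> carrier_mat n n. det g = 1}, mult = (*), one = 1\<^sub>m n\<rparr>"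

definition GL :: "nat \<Rightarrow> complex mat monoid" where
  "GL N = units_of (ring_mat TYPE(complex) N ())"

inductive_set polynomial_functions :: "nat \<Rightarrow> (complex mat \<Rightarrow> complex) set" for n :: nat where
  const: "(\<lambda>g. c) \<in> polynomial_functions n"
| entry: "i < n \<Longrightarrow> j < n \<Longrightarrow> (\<lambda>g. g $$ (i, j)) \<in> polynomial_functions n"
| add: "p \<in> polynomial_functions n \<Longrightarrow> q \<in> polynomial_functions n \<Longrightarrow>
    (\<lambda>g. p g + q g) \<in> polynomial_functions n"
| mult: "p \<in> polynomial_functions n \<Longrightarrow> q \<in> polynomial_functions n \<Longrightarrow>
    (\<lambda>g. p g * q g) \<in> polynomial_functions n"

text \<open>
  Representations are representations of the algebraic group \<open>SL\<^sub>n\<close>: the matrix entries are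
  regular functions on \<open>SL\<^sub>n\<close>, that is, restrictions of polynomials in the entries of \<open>g\<close>.
\<close>

definition rational_representation :: "nat \<Rightarrow> nat \<Rightarrow> (complex mat \<Rightarrow> complex mat) \<Rightarrow> bool" where
  "rational_representation n N \<rho> \<longleftrightarrow>
     \<rho> \<in> hom (SL n) (GL N) \<and>
     (\<forall>i<N. \<forall>j<N. \<exists>p\<in>polynomial_functions n. \<forall>g\<in>carrier (SL n). \<rho> g $$ (i, j) = p g)"

definition irreducible_representation ::
    "nat \<Rightarrow> nat \<Rightarrow> (complex mat \<Rightarrow> complex mat) \<Rightarrow> bool" where
  "irreducible_representation n N \<rho> \<longleftrightarrow>
     rational_representation n N \<rho> \<and> N > 0 \<and>
     (\<forall>W. VectorSpace.subspace class_ring W (module_vec TYPE(complex) N) \<and>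
          (\<forall>g\<in>carrier (SL n). \<forall>w\<in>W. \<rho> g *\<^sub>v w \<in> W) \<longrightarrow>
        W = {0\<^sub>v N} \<or> W = carrier_vec N)"

definition dual_rep :: "nat \<Rightarrow> (complex mat \<Rightarrow> complex mat) \<Rightarrow> complex mat \<Rightarrow> complex mat" where
  "dual_rep n \<rho> g = transpose_mat (\<rho> (inv\<^bsub>SL n\<^esub> g))"

text \<open>
  The tensor product of \<open>\<complex>\<^sup>N\<close> and \<open>\<complex>\<^sup>M\<close> is \<open>\<complex>\<^sup>N\<^sup>M\<close>, with \<open>e\<^sub>i \<otimes> e\<^sub>j\<close> the basis vector of
  index \<open>i * M + j\<close>; correspondingly, the tensor product of linear maps is the Kronecker product.
\<close>

definition tensor_vec :: "complex vec \<Rightarrow> complex vec \<Rightarrow> complex vec" where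
  "tensor_vec v w = vec (dim_vec v * dim_vec w)
     (\<lambda>r. v $ (r div dim_vec w) * w $ (r mod dim_vec w))"

definition tensor_mat :: "complex mat \<Rightarrow> complex mat \<Rightarrow> complex mat" where
  "tensor_mat A B = mat (dim_row A * dim_row B) (dim_col A * dim_col B)
     (\<lambda>(r, c). A $$ (r div dim_row B, c div dim_col B) * B $$ (r mod dim_row B, c mod dim_col B))"

definition tensor_rep :: "(complex mat \<Rightarrow> complex mat) \<Rightarrow> (complex mat \<Rightarrow> complex mat) \<Rightarrow>
    complex mat \<Rightarrow> complex mat" where
  "tensor_rep \<rho> \<sigma> g = tensor_mat (\<rho> g) (\<sigma> g)"

definition invariant_vector ::
    "nat \<Rightarrow> nat \<Rightarrow> (complex mat \<Rightarrow> complex mat) \<Rightarrow> complex vec \<Rightarrow> bool" where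
  "invariant_vector n N \<rho> v \<longleftrightarrow>
     v \<in> carrier_vec N \<and> (\<forall>g\<in>carrier (SL n). \<rho> g *\<^sub>v v = v)"

section \<open>Weights\<close>

text \<open>
  A weight \<open>\<mu> = \<Sum>\<^sub>i \<mu>\<^sub>i \<omega>\<^sub>i\<close> is given by its coefficients \<open>\<mu> i\<close> for \<open>1 \<le> i \<le> n - 1\<close>; other values
  of the function \<open>\<mu>\<close> play no role.  As a character of the diagonal torus, \<open>\<omega>\<^sub>i\<close> maps
  \<open>diag(t\<^sub>1, \<dots>, t\<^sub>n)\<close> to \<open>t\<^sub>1 \<cdots> t\<^sub>i\<close>.
\<close>

definition weight_character :: "nat \<Rightarrow> (nat \<Rightarrow> int) \<Rightarrow> complex mat \<Rightarrow> complex" where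
  "weight_character n \<mu> t = (\<Prod>i=1..n-1. (\<Prod>j=1..i. t $$ (j-1, j-1)) powi \<mu> i)"

definition weight_vector ::
    "nat \<Rightarrow> nat \<Rightarrow> (complex mat \<Rightarrow> complex mat) \<Rightarrow> (nat \<Rightarrow> int) \<Rightarrow> complex vec \<Rightarrow> bool" where
  "weight_vector n N \<rho> \<mu> v \<longleftrightarrow>
     v \<in> carrier_vec N \<and> v \<noteq> 0\<^sub>v N \<and>
     (\<forall>t\<in>carrier (SL n). diagonal_mat t \<longrightarrow> \<rho> t *\<^sub>v v = weight_character n \<mu> t \<cdot>\<^sub>v v)"

text \<open>
  The highest weight of an irreducible representation is the weight of a vector that is fixed by
  the upper unitriangular matrices.
\<close>

definition has_highest_weight ::
    "nat \<Rightarrow> nat \<Rightarrow> (complex mat \<Rightarrow> complex mat) \<Rightarrow> (nat \<Rightarrow> nat) \<Rightarrow> bool" where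
  "has_highest_weight n N \<rho> a \<longleftrightarrow>
     (\<exists>v. weight_vector n N \<rho> (\<lambda>i. int (a i)) v \<and>
          (\<forall>u\<in>carrier (SL n). upper_triangular u \<and> (\<forall>i<n. u $$ (i, i) = 1) \<longrightarrow> \<rho> u *\<^sub>v v = v))"

definition irreducible_of_highest_weight ::
    "nat \<Rightarrow> nat \<Rightarrow> (complex mat \<Rightarrow> complex mat) \<Rightarrow> (nat \<Rightarrow> nat) \<Rightarrow> bool" where
  "irreducible_of_highest_weight n N \<rho> a \<longleftrightarrow>
     irreducible_representation n N \<rho> \<and> has_highest_weight n N \<rho> a"

section \<open>Gelfand--Tsetlin patterns\<close>

type_synonym pattern = "nat \<Rightarrow> nat \<Rightarrow> int"

definition partition_of :: "nat \<Rightarrow> (nat \<Rightarrow> nat) \<Rightarrow> nat \<Rightarrow> nat" where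
  "partition_of n a i = (\<Sum>j=i..n-1. a j)"

text \<open>The entries outside the triangle are 0, so that distinct members of \<open>GT n a\<close> are distinct patterns.\<close>

definition GT :: "nat \<Rightarrow> (nat \<Rightarrow> nat) \<Rightarrow> pattern set" where
  "GT n a = {P.
     (\<forall>k i. \<not> (1 \<le> i \<and> i \<le> k \<and> k \<le> n) \<longrightarrow> P k i = 0) \<and>
     (\<forall>k i. 1 \<le> i \<and> i \<le> k \<and> k \<le> n \<longrightarrow> P k i \<ge> 0) \<and>
     (\<forall>i\<in>{1..n}. P n i = int (partition_of n a i)) \<and>
     (\<forall>k\<in>{2..n}. \<forall>i\<in>{1..k-1}. P k i \<ge> P (k-1) i \<and> P (k-1) i \<ge> P k (i+1))}"

definition shifted :: "pattern \<Rightarrow> nat \<Rightarrow> nat \<Rightarrow> int" where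
  "shifted P k i = P k i - int i + 1"

definition add_entry :: "pattern \<Rightarrow> nat \<Rightarrow> nat \<Rightarrow> int \<Rightarrow> pattern" where
  "add_entry P k i c = P(k := (P k)(i := P k i + c))"

definition dual_pattern :: "nat \<Rightarrow> pattern \<Rightarrow> pattern" where
  "dual_pattern n P =
     (\<lambda>i j. if 1 \<le> j \<and> j \<le> i \<and> i \<le> n then P n 1 - P i (i + 1 - j) else 0)"

definition pattern_weight :: "pattern \<Rightarrow> nat \<Rightarrow> int" where
  "pattern_weight P i =
     - (\<Sum>j=1..i-1. P (i-1) j) + 2 * (\<Sum>j=1..i. P i j) - (\<Sum>j=1..i+1. P (i+1) j)"

text \<open>
  \<open>simple_root j i\<close> is the coefficient of \<open>\<omega>\<^sub>i\<close> in \<open>\<alpha>\<^sub>j = - \<omega>\<^bsub>j-1\<^esub> + 2 \<omega>\<^sub>j - \<omega>\<^bsub>j+1\<^esub>\<close>, where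
  \<open>\<omega>\<^sub>0 = \<omega>\<^sub>n = 0\<close>.
\<close>

definition simple_root :: "nat \<Rightarrow> nat \<Rightarrow> int" where
  "simple_root j i = (if i = j then 2 else if i = j + 1 \<or> j = i + 1 then -1 else 0)"

definition level :: "nat \<Rightarrow> (nat \<Rightarrow> nat) \<Rightarrow> pattern \<Rightarrow> int" where
  "level n a P = (THE L. \<exists>k :: nat \<Rightarrow> int.
     (\<forall>i\<in>{1..n-1}. pattern_weight P i = int (a i) - (\<Sum>j=1..n-1. k j * simple_root j i)) \<and>
     L = (\<Sum>i=1..n-1. k i))"

definition ifact :: "int \<Rightarrow> real" where
  "ifact z = fact (nat z)"

definition pattern_norm :: "nat \<Rightarrow> pattern \<Rightarrow> real" where
  "pattern_norm n P = (let l = shifted P in sqrt (\<Prod>t=2..n.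
     (\<Prod>(p, q)\<in>{(p, q). 1 \<le> p \<and> p \<le> q \<and> q < t}.
        ifact (l t p - l (t-1) q) / ifact (l (t-1) p - l (t-1) q)) *
     (\<Prod>(p, q)\<in>{(p, q). 1 \<le> p \<and> p < q \<and> q \<le> t}.
        ifact (l t p - l t q - 1) / ifact (l (t-1) p - l t q - 1))))"

section \<open>Gelfand--Tsetlin bases\<close>

definition matrix_unit :: "nat \<Rightarrow> nat \<Rightarrow> nat \<Rightarrow> complex mat" where
  "matrix_unit n k l = mat n n (\<lambda>(i, j). if i + 1 = k \<and> j + 1 = l then 1 else 0)"

text \<open>
  The action of the Lie algebra element \<open>E\<^bsub>k,l\<^esub>\<close> with \<open>k \<noteq> l\<close> is the derivative at 0 of
  \<open>s \<mapsto> \<rho> (exp (s E\<^bsub>k,l\<^esub>))\<close>.  As the square of \<open>E\<^bsub>k,l\<^esub>\<close> is 0, this exponential is \<open>1 + s E\<^bsub>k,l\<^esub>\<close>.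
\<close>

definition root_vector_action ::
    "nat \<Rightarrow> nat \<Rightarrow> (complex mat \<Rightarrow> complex mat) \<Rightarrow> nat \<Rightarrow> nat \<Rightarrow> complex mat" where
  "root_vector_action n N \<rho> k l =
     mat N N (\<lambda>(i, j). deriv (\<lambda>s. \<rho> (1\<^sub>m n + s \<cdot>\<^sub>m matrix_unit n k l) $$ (i, j)) 0)"

definition raising_coeff :: "pattern \<Rightarrow> nat \<Rightarrow> nat \<Rightarrow> complex" where
  "raising_coeff P k i = (let l = shifted P in
     of_int (- (\<Prod>q=1..k+1. l k i - l (k+1) q)) / of_int (\<Prod>q\<in>{1..k} - {i}. l k i - l k q))"

definition lowering_coeff :: "pattern \<Rightarrow> nat \<Rightarrow> nat \<Rightarrow> complex" where
  "lowering_coeff P k i = (let l = shifted P in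
     of_int (\<Prod>q=1..k-1. l k i - l (k-1) q) / of_int (\<Prod>q\<in>{1..k} - {i}. l k i - l k q))"

definition GT_basis :: "nat \<Rightarrow> nat \<Rightarrow> (complex mat \<Rightarrow> complex mat) \<Rightarrow> (nat \<Rightarrow> nat) \<Rightarrow>
    (pattern \<Rightarrow> complex vec) \<Rightarrow> bool" where
  "GT_basis n N \<rho> a e \<longleftrightarrow>
     inj_on e (GT n a) \<and>
     vectorspace.basis class_ring (module_vec TYPE(complex) N) (e ` GT n a) \<and>
     (\<forall>P\<in>GT n a. \<exists>\<mu>. weight_vector n N \<rho> \<mu> (e P)) \<and>
     (let e0 = (\<lambda>Q. if Q \<in> GT n a then e Q else 0\<^sub>v N) in
      \<forall>P\<in>GT n a. \<forall>k\<in>{1..n-1}.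
        root_vector_action n N \<rho> k (k+1) *\<^sub>v e P =
          finsum_vec TYPE(complex) N (\<lambda>i. raising_coeff P k i \<cdot>\<^sub>v e0 (add_entry P k i 1)) {1..k} \<and>
        root_vector_action n N \<rho> (k+1) k *\<^sub>v e P =
          finsum_vec TYPE(complex) N (\<lambda>i. lowering_coeff P k i \<cdot>\<^sub>v e0 (add_entry P k i (-1))) {1..k})"

text \<open>
  Here \<open>e\<close> and \<open>e'\<close> are bases, indexed by patterns, of an \<open>N\<close>- and an \<open>M\<close>-dimensional space.
\<close>

definition invariant_F :: "nat \<Rightarrow> (nat \<Rightarrow> nat) \<Rightarrow> nat \<Rightarrow> nat \<Rightarrow>
    (pattern \<Rightarrow> complex vec) \<Rightarrow> (pattern \<Rightarrow> complex vec) \<Rightarrow> complex vec" where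
  "invariant_F n a N M e e' = finsum_vec TYPE(complex) (N * M)
     (\<lambda>P. complex_of_real ((-1) powi level n a P /
            (pattern_norm n P * pattern_norm n (dual_pattern n P)))
          \<cdot>\<^sub>v tensor_vec (e P) (e' (dual_pattern n P)))
     (GT n a)"

end

theory Submission
  imports Defs "Jordan_Normal_Form.Column_Operations"
begin

text \<open>
  The group \<open>SL\<^sub>n\<close> is generated by the matrices \<open>1 + s E\<^bsub>k,k+1\<^esub>\<close> and \<open>1 + s E\<^bsub>k+1,k\<^esub>\<close>
  (\<open>SL_induct_simple\<close>), and the derivative of \<open>s \<mapsto> (1 + s E) F\<close> vanishes as soon as the root vector \<open>E\<close> kills \<open>F\<close>
  (\<open>F_fixed_by_root_subgroup\<close>).  So everything rests on the identities \<open>X\<^sub>k F = 0\<close> and \<open>Y\<^sub>k F = 0\<close>.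

  If \<open>P\<close> and \<open>Q = P + \<delta>\<^bsub>k,i\<^esub>\<close> are patterns, then \<open>P\<^sup>*\<close> arises from \<open>Q\<^sup>*\<close> by raising the entry in position
  \<open>(k, k+1-i)\<close>.  Hence \<open>e\<^sub>Q \<otimes> e\<^bsub>P*\<^esub>\<close> occurs exactly twice in \<open>X\<^sub>k F\<close>: in the images of the terms for \<open>P\<close> and for \<open>Q\<close>.
  The two contributions cancel for the following reason.  In \<open>\<parallel>P\<parallel>\<^sup>2 \<parallel>P\<^sup>*\<parallel>\<^sup>2\<close> the factorials that mix
  two rows cancel, and what remains is a square, so that \<open>\<parallel>P\<parallel> \<parallel>P\<^sup>*\<parallel>\<close> is a function of the top row divided by
  the product over \<open>k < n\<close> of the Vandermonde products \<open>\<Prod>\<^bsub>p<q\<^esub> (l\<^bsub>k,p\<^esub> - l\<^bsub>k,q\<^esub>)\<close>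
  (\<open>pattern_norm_mult_dual\<close>).  The quotient of these for \<open>Q\<close> and \<open>P\<close> is the quotient of the denominators
  \<open>\<Prod>\<^bsub>q\<noteq>i\<^esub> (l\<^bsub>k,i\<^esub> + 1 - l\<^bsub>k,q\<^esub>)\<close> and \<open>\<Prod>\<^bsub>q\<noteq>i\<^esub> (l\<^bsub>k,i\<^esub> - l\<^bsub>k,q\<^esub>)\<close> of the two matrix
  coefficients of \<open>X\<^sub>k\<close>, whose numerators agree; and the levels of \<open>P\<close> and \<open>Q\<close> differ by 1, which gives the opposite sign
  (\<open>F_coeff_raising\<close>, \<open>F_coeff_lowering\<close>, \<open>paired_sum_vanishes\<close>).

  For \<open>P\<^sup>*\<close> to index a vector of the second basis it must be known that \<open>\<lambda>\<^sup>*\<close> has the coefficients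
  \<open>a\<^bsub>n-i\<^esub>\<close>.  This is read off from the formulas for the root vectors
  (\<open>dual_highest_weight\<close>): a vector killed by all \<open>X\<^sub>k\<close> is a multiple of the basis vector of the highest
  pattern, and a functional that vanishes on the images of all \<open>X\<^sub>k\<close> lives on the lowest pattern.
  The former pins down the weight of the highest pattern, raising steps transport it to all other
  patterns, and the latter shows that the weight of the lowest pattern is \<open>-\<lambda>\<^sup>*\<close>.
\<close>

section \<open>Patterns\<close>

lemma GT_zero: "P \<in> GT n a \<Longrightarrow> \<not> (1 \<le> i \<and> i \<le> k \<and> k \<le> n) \<Longrightarrow> P k i = 0"
  unfolding GT_def by blast

lemma GT_top: "P \<in> GT n a \<Longrightarrow> 1 \<le> i \<Longrightarrow> i \<le> n \<Longrightarrow> P n i = int (partition_of n a i)"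
  unfolding GT_def by auto

lemma GT_interlace:
  assumes "P \<in> GT n a" "1 \<le> k" "k < n" "1 \<le> i" "i \<le> k"
  shows "P k i \<le> P (Suc k) i" "P (Suc k) (Suc i) \<le> P k i"
proof -
  have *: "\<forall>k\<in>{2..n}. \<forall>i\<in>{1..k-1}. P k i \<ge> P (k-1) i \<and> P (k-1) i \<ge> P k (i+1)"
    using assms(1) unfolding GT_def by blast
  from *[rule_format, of "Suc k" i] assms
  show "P k i \<le> P (Suc k) i" "P (Suc k) (Suc i) \<le> P k i" by auto
qed

lemma GT_row_decreasing:
  assumes "P \<in> GT n a" "1 \<le> i" "i \<le> j" "j \<le> k" "k \<le> n"
  shows "P k j \<le> P k i"
  using assms(3,4)
proof (induction j rule: dec_induct)
  case (step m)
  have "P k (Suc m) \<le> P (k - 1) m" "P (k - 1) m \<le> P k m"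
    using GT_interlace[OF assms(1), of "k - 1" m] step.hyps step.prems assms(2,5) by auto
  with step show ?case by auto
qed simp

lemma GT_column_increasing:
  assumes "P \<in> GT n a" "1 \<le> i" "i \<le> k" "k \<le> m" "m \<le> n"
  shows "P k i \<le> P m i"
  using assms(4,5)
proof (induction m rule: dec_induct)
  case (step m)
  have "P m i \<le> P (Suc m) i"
    using GT_interlace(1)[OF assms(1), of m i] step.hyps step.prems assms(2,3) by auto
  with step show ?case by auto
qed simp

lemma GT_top_difference:
  assumes "P \<in> GT n a" "1 \<le> i" "i \<le> j" "j \<le> n"
  shows "P n i - P n j = int (\<Sum>m=i..<j. a m)"
proof -
  have "{i..n-1} = {i..<j} \<union> {j..n-1}" "{i..<j} \<inter> {j..n-1} = {}" using assms by auto
  then have "partition_of n a i = (\<Sum>m=i..<j. a m) + partition_of n a j"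
    unfolding partition_of_def by (metis finite_atLeastAtMost finite_atLeastLessThan sum.union_disjoint)
  then show ?thesis using GT_top[OF assms(1)] assms by simp
qed

lemma GT_last_zero: "P \<in> GT n a \<Longrightarrow> n \<ge> 1 \<Longrightarrow> P n n = 0"
  using GT_top[of P n a n] by (cases n) (auto simp: partition_of_def)

text \<open>Nonnegativity of the entries follows from interlacing and \<open>\<pi>\<^sub>n = 0\<close>.\<close>

lemma GT_iff:
  "P \<in> GT n a \<longleftrightarrow>
     (\<forall>k i. \<not> (1 \<le> i \<and> i \<le> k \<and> k \<le> n) \<longrightarrow> P k i = 0) \<and>
     (\<forall>i. 1 \<le> i \<longrightarrow> i \<le> n \<longrightarrow> P n i = int (partition_of n a i)) \<and>
     (\<forall>k i. 1 \<le> i \<longrightarrow> i \<le> k \<longrightarrow> k < n \<longrightarrow> P k i \<le> P (Suc k) i \<and> P (Suc k) (Suc i) \<le> P k i)"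
  (is "?l \<longleftrightarrow> ?r")
proof
  assume P: ?l
  then show ?r using GT_zero[OF P] GT_top[OF P] GT_interlace[OF P] by auto
next
  assume r: ?r
  have nonneg: "P k i \<ge> 0" if "1 \<le> i" "i \<le> k" "k \<le> n" for k i
    using that(3,1,2)
  proof (induction k arbitrary: i rule: inc_induct)
    case base
    then show ?case using r by auto
  next
    case (step m)
    have "P (Suc m) (Suc i) \<ge> 0" using step.IH[of "Suc i"] step.prems by simp
    moreover have "P (Suc m) (Suc i) \<le> P m i" using r step by simp
    ultimately show ?case by simp
  qed
  have inter: "P (k - 1) i \<le> P k i \<and> P k (i + 1) \<le> P (k - 1) i"
    if "k \<in> {2..n}" "i \<in> {1..k-1}" for k i
  proof -
    have "k = Suc (k - 1)" using that by simp
    then obtain m where "k = Suc m" by blast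
    then show ?thesis using r that by simp
  qed
  show ?l unfolding GT_def using r nonneg inter by simp
qed

lemma add_entry_apply:
  "add_entry P k i c m j = (if m = k \<and> j = i then P k i + c else P m j)"
  by (simp add: add_entry_def)

lemma add_entry_cancel [simp]:
  "add_entry (add_entry P k i c) k i (- c) = P" "add_entry (add_entry P k i (- c)) k i c = P"
  by (auto simp: add_entry_apply fun_eq_iff)

section \<open>Extremal patterns\<close>

text \<open>
  In the application \<open>\<phi>\<close> consists of the values of a functional at the basis vectors, and the sum
  is its value at the image of a basis vector under a raising operator.  The rows are dealt with
  one after the other, from the first one on.  If the entry \<open>Q k i\<close> is not minimal, then \<open>Q\<close> arises
  from a pattern \<open>P\<close> by raising that entry, and every other pattern obtained from \<open>P\<close> by raising an
  entry of row \<open>k\<close> violates minimality in row \<open>k - 1\<close>.  So the sum for \<open>P\<close> has only one nonzero term.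
\<close>

lemma annihilated_imp_lowest:
  fixes \<phi> :: "pattern \<Rightarrow> complex"
  assumes kill: "\<And>P k. P \<in> GT n a \<Longrightarrow> 1 \<le> k \<Longrightarrow> k < n \<Longrightarrow>
      (\<Sum>i=1..k. if add_entry P k i 1 \<in> GT n a then C P k i * \<phi> (add_entry P k i 1) else 0) = 0"
    and nz: "\<And>P k i. P \<in> GT n a \<Longrightarrow> add_entry P k i 1 \<in> GT n a \<Longrightarrow> 1 \<le> i \<Longrightarrow> i \<le> k \<Longrightarrow> k < n \<Longrightarrow>
      C P k i \<noteq> 0"
    and "Q \<in> GT n a" "\<phi> Q \<noteq> 0" "1 \<le> i" "i \<le> k" "k < n"
  shows "Q k i = Q (Suc k) (Suc i)"
  using assms(3-)
proof (induction k arbitrary: Q i rule: less_induct)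
  case (less k)
  show ?case
  proof (rule ccontr)
    assume ne: "Q k i \<noteq> Q (Suc k) (Suc i)"
    define P where "P = add_entry Q k i (-1)"
    have Q: "Q = add_entry P k i 1" using add_entry_cancel(2)[of Q k i 1] by (simp add: P_def)
    note inter = GT_interlace[OF less.prems(1)]
    have gt: "Q k i > Q (Suc k) (Suc i)" using inter(2)[of k i] ne less.prems by simp
    \<comment> \<open>Minimality in row \<open>k - 1\<close> leaves room for lowering the entry.\<close>
    have below: "Q (k - 1) i < Q k i" if "i \<le> k - 1"
    proof -
      have "Q (k - 1) i = Q k (Suc i)"
        using less.IH[of "k - 1" Q i] less.prems that by auto
      moreover have "Q k (Suc i) \<le> Q (Suc k) (Suc i)"
        using inter(1)[of k "Suc i"] less.prems that by auto
      ultimately show ?thesis using gt by simp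
    qed
    have P: "P \<in> GT n a"
      unfolding GT_iff
    proof (intro conjI allI impI)
      fix m j assume "\<not> (1 \<le> j \<and> j \<le> m \<and> m \<le> n)"
      then show "P m j = 0"
        using GT_zero[OF less.prems(1)] less.prems by (auto simp: P_def add_entry_apply)
    next
      fix j assume "1 \<le> j" "j \<le> n"
      then show "P n j = int (partition_of n a j)"
        using GT_top[OF less.prems(1)] less.prems by (auto simp: P_def add_entry_apply)
    next
      fix m j assume mj: "1 \<le> j" "j \<le> m" "m < n"
      have "Q m j \<le> Q (Suc m) j" "Q (Suc m) (Suc j) \<le> Q m j" using inter[of m j] mj by auto
      then show "P m j \<le> P (Suc m) j" "P (Suc m) (Suc j) \<le> P m j"
        using gt below mj by (auto simp: P_def add_entry_apply)
    qed
    have others: "\<phi> (add_entry P k j 1) = 0"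
      if R: "add_entry P k j 1 \<in> GT n a" and j: "1 \<le> j" "j \<le> k" "j \<noteq> i" for j
    proof (rule ccontr)
      assume nz': "\<phi> (add_entry P k j 1) \<noteq> 0"
      define R where "R = add_entry P k j 1"
      have low: "R (k - 1) m = R k (Suc m)" if "1 \<le> m" "m \<le> k - 1" for m
        using less.IH[of "k - 1" R m] that R nz' less.prems by (auto simp: R_def)
      show False
      \<comment> \<open>For \<open>j = 1\<close> there is no entry of row \<open>k - 1\<close> to compare with; but then the lowered entry \<open>i\<close> is out of place.\<close>
      proof (cases "j = 1")
        case True
        have "R (k - 1) (i - 1) = R k i" using low[of "i - 1"] j True less.prems by auto
        then have "Q (k - 1) (i - 1) = Q k i - 1"
          using j True less.prems by (auto simp: R_def P_def add_entry_apply split: if_splits)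
        moreover have "Q (k - 1) (i - 1) = Q k i"
          using less.IH[of "k - 1" Q "i - 1"] j True less.prems by auto
        ultimately show False by simp
      next
        case False
        have "R (k - 1) (j - 1) = R k j" using low[of "j - 1"] j False less.prems by auto
        then have "Q (k - 1) (j - 1) = Q k j + 1"
          using j less.prems by (auto simp: R_def P_def add_entry_apply split: if_splits)
        moreover have "Q (k - 1) (j - 1) = Q k j"
          using less.IH[of "k - 1" Q "j - 1"] j False less.prems by auto
        ultimately show False by simp
      qed
    qed
    have "0 = (\<Sum>j=1..k. if add_entry P k j 1 \<in> GT n a then C P k j * \<phi> (add_entry P k j 1) else 0)"
      using kill[OF P, of k] less.prems by simp
    also have "\<dots> = (\<Sum>j=1..k. if j = i then C P k i * \<phi> Q else 0)"
      by (rule sum.cong) (use others less.prems Q in auto)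
    also have "\<dots> = C P k i * \<phi> Q" using less.prems by simp
    finally show False using nz[of P k i] P Q less.prems by auto
  qed
qed

text \<open>
  The mirror image of \<open>annihilated_imp_lowest\<close>: in the application \<open>\<phi>\<close> consists of the coordinates
  of a vector killed by all raising operators, and the sum is a coordinate of its image.
\<close>

lemma annihilated_imp_highest:
  fixes \<phi> :: "pattern \<Rightarrow> complex"
  assumes kill: "\<And>P k. P \<in> GT n a \<Longrightarrow> 1 \<le> k \<Longrightarrow> k < n \<Longrightarrow>
      (\<Sum>i=1..k. if add_entry P k i (-1) \<in> GT n a then C P k i * \<phi> (add_entry P k i (-1)) else 0) = 0"
    and nz: "\<And>P k i. P \<in> GT n a \<Longrightarrow> add_entry P k i (-1) \<in> GT n a \<Longrightarrow> 1 \<le> i \<Longrightarrow> i \<le> k \<Longrightarrow> k < n \<Longrightarrow>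
      C P k i \<noteq> 0"
    and "Q \<in> GT n a" "\<phi> Q \<noteq> 0" "1 \<le> i" "i \<le> k" "k < n"
  shows "Q k i = Q (Suc k) i"
  using assms(3-)
proof (induction k arbitrary: Q i rule: less_induct)
  case (less k)
  show ?case
  proof (rule ccontr)
    assume ne: "Q k i \<noteq> Q (Suc k) i"
    define P where "P = add_entry Q k i 1"
    have Q: "Q = add_entry P k i (-1)" using add_entry_cancel(1)[of Q k i 1] by (simp add: P_def)
    note inter = GT_interlace[OF less.prems(1)]
    have lt: "Q k i < Q (Suc k) i" using inter(1)[of k i] ne less.prems by simp
    \<comment> \<open>Maximality in row \<open>k - 1\<close> leaves room for raising the entry.\<close>
    have above: "Q k i < Q (k - 1) (i - 1)" if "i > 1"
    proof -
      have "Q (k - 1) (i - 1) = Q k (i - 1)"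
        using less.IH[of "k - 1" Q "i - 1"] less.prems that by auto
      moreover have "Q (Suc k) i \<le> Q k (i - 1)"
        using inter(2)[of k "i - 1"] less.prems that by auto
      ultimately show ?thesis using lt by simp
    qed
    have P: "P \<in> GT n a"
      unfolding GT_iff
    proof (intro conjI allI impI)
      fix m j assume "\<not> (1 \<le> j \<and> j \<le> m \<and> m \<le> n)"
      then show "P m j = 0"
        using GT_zero[OF less.prems(1)] less.prems by (auto simp: P_def add_entry_apply)
    next
      fix j assume "1 \<le> j" "j \<le> n"
      then show "P n j = int (partition_of n a j)"
        using GT_top[OF less.prems(1)] less.prems by (auto simp: P_def add_entry_apply)
    next
      fix m j assume mj: "1 \<le> j" "j \<le> m" "m < n"
      have "Q m j \<le> Q (Suc m) j" "Q (Suc m) (Suc j) \<le> Q m j" using inter[of m j] mj by auto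
      then show "P m j \<le> P (Suc m) j" "P (Suc m) (Suc j) \<le> P m j"
        using lt above mj by (auto simp: P_def add_entry_apply)
    qed
    have others: "\<phi> (add_entry P k j (-1)) = 0"
      if R: "add_entry P k j (-1) \<in> GT n a" and j: "1 \<le> j" "j \<le> k" "j \<noteq> i" for j
    proof (rule ccontr)
      assume nz': "\<phi> (add_entry P k j (-1)) \<noteq> 0"
      define R where "R = add_entry P k j (-1)"
      have high: "R (k - 1) m = R k m" if "1 \<le> m" "m \<le> k - 1" for m
        using less.IH[of "k - 1" R m] that R nz' less.prems by (auto simp: R_def)
      show False
      \<comment> \<open>For \<open>j = k\<close> there is no entry of row \<open>k - 1\<close> to compare with; but then the raised entry \<open>i\<close> is out of place.\<close>
      proof (cases "j = k")
        case True
        have "R (k - 1) i = R k i" using high[of i] j True less.prems by auto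
        then have "Q (k - 1) i = Q k i + 1"
          using j less.prems by (auto simp: R_def P_def add_entry_apply split: if_splits)
        moreover have "Q (k - 1) i = Q k i"
          using less.IH[of "k - 1" Q i] j True less.prems by auto
        ultimately show False by simp
      next
        case False
        have "R (k - 1) j = R k j" using high[of j] j False less.prems by auto
        then have "Q (k - 1) j = Q k j - 1"
          using j less.prems by (auto simp: R_def P_def add_entry_apply split: if_splits)
        moreover have "Q (k - 1) j = Q k j"
          using less.IH[of "k - 1" Q j] j False less.prems by auto
        ultimately show False by simp
      qed
    qed
    have "0 = (\<Sum>j=1..k. if add_entry P k j (-1) \<in> GT n a then C P k j * \<phi> (add_entry P k j (-1)) else 0)"
      using kill[OF P, of k] less.prems by simp
    also have "\<dots> = (\<Sum>j=1..k. if j = i then C P k i * \<phi> Q else 0)"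
      by (rule sum.cong) (use others less.prems Q in auto)
    also have "\<dots> = C P k i * \<phi> Q" using less.prems by simp
    finally show False using nz[of P k i] P Q less.prems by auto
  qed
qed

text \<open>
  An entry \<open>P k i\<close> below its bound \<open>P (k + 1) i\<close> can be raised unless \<open>P (k - 1) (i - 1)\<close> is equal to it.
  In that case the latter entry is below its own bound \<open>P k (i - 1)\<close>, because
  \<open>P (k + 1) i \<le> P k (i - 1)\<close>; so one can move to the left until an entry can be raised.
\<close>

lemma raisable_entry_exists:
  assumes P: "P \<in> GT n a" and "1 \<le> i" "i \<le> k" "k < n" "P k i \<noteq> P (Suc k) i"
  shows "\<exists>m j. 1 \<le> j \<and> j \<le> m \<and> m < n \<and> add_entry P m j 1 \<in> GT n a"
  using assms(2-)
proof (induction i arbitrary: k)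
  case (Suc i)
  note inter = GT_interlace[OF P]
  show ?case
  proof (cases "i \<ge> 1 \<and> P (k - 1) i \<noteq> P k i")
    case True
    then show ?thesis using Suc.IH[of "k - 1"] Suc.prems by auto
  next
    case False
    have lt: "P k (Suc i) < P (Suc k) (Suc i)" using inter(1)[of k "Suc i"] Suc.prems by simp
    have above: "P k (Suc i) < P (k - 1) i" if "i \<ge> 1"
      using inter(2)[of k i] False that lt Suc.prems by auto
    have "add_entry P k (Suc i) 1 \<in> GT n a"
      unfolding GT_iff
    proof (intro conjI allI impI)
      fix m j assume "\<not> (1 \<le> j \<and> j \<le> m \<and> m \<le> n)"
      then show "add_entry P k (Suc i) 1 m j = 0"
        using GT_zero[OF P] Suc.prems by (auto simp: add_entry_apply)
    next
      fix j assume "1 \<le> j" "j \<le> n"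
      then show "add_entry P k (Suc i) 1 n j = int (partition_of n a j)"
        using GT_top[OF P] Suc.prems by (auto simp: add_entry_apply)
    next
      fix m j assume mj: "1 \<le> j" "j \<le> m" "m < n"
      have "P m j \<le> P (Suc m) j" "P (Suc m) (Suc j) \<le> P m j" using inter[of m j] mj by auto
      then show "add_entry P k (Suc i) 1 m j \<le> add_entry P k (Suc i) 1 (Suc m) j"
        "add_entry P k (Suc i) 1 (Suc m) (Suc j) \<le> add_entry P k (Suc i) 1 m j"
        using lt above mj by (auto simp: add_entry_apply)
    qed
    then show ?thesis using Suc.prems by auto
  qed
qed simp

section \<open>Weights and levels\<close>

definition row_sum :: "pattern \<Rightarrow> nat \<Rightarrow> int" where
  "row_sum P k = (\<Sum>j=1..k. P k j)"

lemma pattern_weight_row_sum: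
  "1 \<le> i \<Longrightarrow> pattern_weight P i = - row_sum P (i - 1) + 2 * row_sum P i - row_sum P (i + 1)"
  by (simp add: pattern_weight_def row_sum_def)

lemma row_sum_add_entry:
  assumes "1 \<le> i" "i \<le> k"
  shows "row_sum (add_entry P k i c) m = row_sum P m + (if m = k then c else 0)"
proof (cases "m = k")
  case True
  have "row_sum (add_entry P k i c) k = (\<Sum>j=1..k. P k j + (if j = i then c else 0))"
    unfolding row_sum_def by (rule sum.cong) (auto simp: add_entry_apply)
  then show ?thesis using True assms by (simp add: sum.distrib row_sum_def)
qed (simp add: row_sum_def add_entry_apply)

lemma pattern_weight_add_entry:
  assumes "1 \<le> j" "j \<le> k" "1 \<le> i"
  shows "pattern_weight (add_entry P k j c) i = pattern_weight P i + c * simple_root k i"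
  using assms by (auto simp: pattern_weight_row_sum row_sum_add_entry simple_root_def)

lemma sum_simple_root:
  fixes k :: "nat \<Rightarrow> int"
  assumes "k 0 = 0" "k n = 0" "1 \<le> i" "i < n"
  shows "(\<Sum>j=1..n-1. k j * simple_root j i) = 2 * k i - k (i - 1) - k (i + 1)"
proof -
  obtain m where m: "i = Suc m" using assms(3) by (cases i) auto
  have "(\<Sum>j=1..n-1. k j * simple_root j i) = (\<Sum>j\<in>{m, Suc m, Suc (Suc m)}. k j * simple_root j i)"
  proof (rule sum.mono_neutral_cong)
    fix j assume "j \<in> {m, Suc m, Suc (Suc m)} - {1..n-1}"
    then have "j = 0 \<or> j = n" using assms(3,4) m by auto
    then show "k j * simple_root j i = 0" using assms(1,2) by auto
  qed (auto simp: simple_root_def m)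
  also have "\<dots> = 2 * k i - k (i - 1) - k (i + 1)"
    by (simp add: simple_root_def m)
  finally show ?thesis .
qed

text \<open>
  The Cartan matrix of type \<open>A\<close> is nondegenerate: a solution of the homogeneous system is an
  arithmetic progression that vanishes at both ends.
\<close>

lemma simple_roots_independent:
  fixes k :: "nat \<Rightarrow> int"
  assumes "\<And>i. 1 \<le> i \<Longrightarrow> i < n \<Longrightarrow> (\<Sum>j=1..n-1. k j * simple_root j i) = 0"
    and "1 \<le> i" "i < n"
  shows "k i = 0"
proof -
  define h where "h = (\<lambda>j. if 1 \<le> j \<and> j < n then k j else 0)"
  have h: "2 * h i - h (i - 1) - h (i + 1) = 0" if "1 \<le> i" "i < n" for i
  proof -
    have "(\<Sum>j=1..n-1. h j * simple_root j i) = (\<Sum>j=1..n-1. k j * simple_root j i)"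
      by (rule sum.cong) (use that in \<open>auto simp: h_def\<close>)
    then show ?thesis
      using sum_simple_root[of h n i] assms(1)[of i] that by (simp add: h_def)
  qed
  have lin: "h m = int m * h 1 \<and> h (Suc m) = int (Suc m) * h 1" if "m < n" for m
    using that
  proof (induction m)
    case (Suc m)
    have "h (Suc (Suc m)) = 2 * h (Suc m) - h m"
      using h[of "Suc m"] Suc.prems by simp
    with Suc show ?case by (simp add: algebra_simps)
  qed (simp add: h_def)
  obtain m where m: "n = Suc m" using assms(3) by (cases n) auto
  have "int n * h 1 = 0" using lin[of m] by (simp add: m h_def)
  then have "h 1 = 0" using assms(3) by simp
  then show ?thesis using lin[of i] assms(2,3) by (simp add: h_def)
qed

text \<open>
  The coefficient of \<open>\<alpha>\<^sub>k\<close> in \<open>\<lambda> - wt(P)\<close> is the amount by which the sum of row \<open>k\<close> falls short of the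
  one of the highest pattern; the shortfall is 0 for \<open>k = 0\<close> and \<open>k = n\<close>.
\<close>

lemma level_eq:
  assumes P: "P \<in> GT n a"
  shows "level n a P = (\<Sum>k=1..n-1. (\<Sum>j=1..k. int (partition_of n a j)) - row_sum P k)"
proof -
  define S where "S = (\<lambda>k. \<Sum>j=1..k. int (partition_of n a j))"
  define d where "d = (\<lambda>k. S k - row_sum P k)"
  have d_ends: "d 0 = 0" "d n = 0"
    using GT_top[OF P] by (auto simp: d_def S_def row_sum_def intro!: sum.cong)
  have d: "pattern_weight P i = int (a i) - (\<Sum>j=1..n-1. d j * simple_root j i)"
    if i: "i \<in> {1..n-1}" for i
  proof -
    have i': "1 \<le> i" "i < n" using i by auto
    have "{i..n - 1} = insert i {i + 1..n - 1}" using i by auto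
    then have "int (partition_of n a i) - int (partition_of n a (i + 1)) = int (a i)"
      by (simp add: partition_of_def)
    moreover obtain m where "i = Suc m" using i' by (cases i) auto
    ultimately have "2 * S i - S (i - 1) - S (i + 1) = int (a i)"
      by (simp add: S_def)
    then show ?thesis
      unfolding sum_simple_root[of d, OF d_ends i'] pattern_weight_row_sum[OF i'(1)]
      by (simp add: d_def)
  qed
  show ?thesis
    unfolding level_def
  proof (rule the_equality)
    show "\<exists>k. (\<forall>i\<in>{1..n - 1}. pattern_weight P i = int (a i) - (\<Sum>j=1..n - 1. k j * simple_root j i)) \<and>
        (\<Sum>k=1..n-1. (\<Sum>j=1..k. int (partition_of n a j)) - row_sum P k) = (\<Sum>i=1..n - 1. k i)"
      using d by (intro exI[of _ d]) (auto simp: d_def S_def)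
  next
    fix L assume "\<exists>k. (\<forall>i\<in>{1..n - 1}. pattern_weight P i = int (a i) - (\<Sum>j=1..n - 1. k j * simple_root j i)) \<and>
      L = (\<Sum>i=1..n - 1. k i)"
    then obtain k where k: "\<forall>i\<in>{1..n - 1}. pattern_weight P i = int (a i) - (\<Sum>j=1..n - 1. k j * simple_root j i)"
      and L: "L = (\<Sum>i=1..n - 1. k i)" by blast
    have "(\<Sum>j=1..n-1. (k j - d j) * simple_root j i) = 0" if "1 \<le> i" "i < n" for i
      using k[rule_format, of i] d[of i] that by (simp add: left_diff_distrib sum_subtractf)
    then have "k i - d i = 0" if "1 \<le> i" "i < n" for i
      using simple_roots_independent[of n "\<lambda>j. k j - d j" i] that by blast
    then have "L = (\<Sum>i=1..n-1. d i)"
      unfolding L by (intro sum.cong) auto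
    then show "L = (\<Sum>k=1..n-1. (\<Sum>j=1..k. int (partition_of n a j)) - row_sum P k)"
      by (simp add: d_def S_def)
  qed
qed

lemma level_add_entry:
  assumes "P \<in> GT n a" "add_entry P k i c \<in> GT n a" "1 \<le> i" "i \<le> k" "k < n"
  shows "level n a (add_entry P k i c) = level n a P - c"
proof -
  have "level n a (add_entry P k i c) =
      (\<Sum>m=1..n-1. ((\<Sum>j=1..m. int (partition_of n a j)) - row_sum P m) - (if m = k then c else 0))"
    unfolding level_eq[OF assms(2)] row_sum_add_entry[OF assms(3,4)]
    by (intro sum.cong) auto
  also have "\<dots> = level n a P - c"
    using assms(3-5) by (simp add: level_eq[OF assms(1)] sum_subtractf)
  finally show ?thesis .
qed

lemma level_nonneg:
  assumes P: "P \<in> GT n a"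
  shows "level n a P \<ge> 0"
  unfolding level_eq[OF P]
proof (intro sum_nonneg)
  fix k assume k: "k \<in> {1..n - 1}"
  have "row_sum P k \<le> (\<Sum>j=1..k. int (partition_of n a j))"
    unfolding row_sum_def
  proof (rule sum_mono)
    fix j assume j: "j \<in> {1..k}"
    have "P k j \<le> P n j" by (rule GT_column_increasing[OF P]) (use j k in auto)
    then show "P k j \<le> int (partition_of n a j)" using GT_top[OF P, of j] j k by auto
  qed
  then show "0 \<le> (\<Sum>j=1..k. int (partition_of n a j)) - row_sum P k" by simp
qed

lemma highest_pattern_entry:
  assumes "P \<in> GT n a" and high: "\<And>k i. 1 \<le> i \<Longrightarrow> i \<le> k \<Longrightarrow> k < n \<Longrightarrow> P k i = P (Suc k) i"
    and "k \<le> n" "1 \<le> i" "i \<le> k"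
  shows "P k i = P n i"
  using assms(3-)
  by (induction k rule: inc_induct) (simp_all add: high)

lemma lowest_pattern_entry:
  assumes "P \<in> GT n a" and low: "\<And>k i. 1 \<le> i \<Longrightarrow> i \<le> k \<Longrightarrow> k < n \<Longrightarrow> P k i = P (Suc k) (Suc i)"
    and "k \<le> n" "1 \<le> i" "i \<le> k"
  shows "P k i = P n (i + (n - k))"
  using assms(3-)
proof (induction k arbitrary: i rule: inc_induct)
  case (step m)
  have "P m i = P (Suc m) (Suc i)" using step low by simp
  also have "\<dots> = P n (Suc i + (n - Suc m))" by (rule step.IH) (use step.prems in auto)
  also have "Suc i + (n - Suc m) = i + (n - m)" using step.hyps by simp
  finally show ?case .
qed simp

lemma highest_pattern_unique:
  assumes P: "P \<in> GT n a" and Q: "Q \<in> GT n a"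
    and "\<And>k i. 1 \<le> i \<Longrightarrow> i \<le> k \<Longrightarrow> k < n \<Longrightarrow> P k i = P (Suc k) i"
    and "\<And>k i. 1 \<le> i \<Longrightarrow> i \<le> k \<Longrightarrow> k < n \<Longrightarrow> Q k i = Q (Suc k) i"
  shows "P = Q"
proof (intro ext)
  fix k i
  show "P k i = Q k i"
  proof (cases "1 \<le> i \<and> i \<le> k \<and> k \<le> n")
    case True
    then show ?thesis
      using highest_pattern_entry[OF P assms(3), of k i] highest_pattern_entry[OF Q assms(4), of k i]
        GT_top[OF P, of i] GT_top[OF Q, of i] by auto
  next
    case False
    then show ?thesis using GT_zero[OF P, of i k] GT_zero[OF Q, of i k] by simp
  qed
qed

lemma highest_pattern_weight:
  assumes P: "P \<in> GT n a" and high: "\<And>k i. 1 \<le> i \<Longrightarrow> i \<le> k \<Longrightarrow> k < n \<Longrightarrow> P k i = P (Suc k) i"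
    and i: "1 \<le> i" "i < n"
  shows "pattern_weight P i = int (a i)"
proof -
  have S: "row_sum P k = (\<Sum>j=1..k. P n j)" if "k \<le> n" for k
    unfolding row_sum_def
    by (rule sum.cong[OF refl]) (use highest_pattern_entry[OF P high that] in auto)
  obtain m where m: "i = Suc m" using i by (cases i) auto
  show ?thesis
    using GT_top_difference[OF P, of i "Suc i"] i by (simp add: pattern_weight_row_sum S m)
qed

lemma lowest_pattern_weight:
  assumes P: "P \<in> GT n a" and low: "\<And>k i. 1 \<le> i \<Longrightarrow> i \<le> k \<Longrightarrow> k < n \<Longrightarrow> P k i = P (Suc k) (Suc i)"
    and i: "1 \<le> i" "i < n"
  shows "pattern_weight P i = - int (a (n - i))"
proof -
  have S: "row_sum P k = (\<Sum>j=n+1-k..n. P n j)" if "k \<le> n" for k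
    unfolding row_sum_def
    by (rule sum.reindex_bij_witness[of _ "\<lambda>j. j - (n - k)" "\<lambda>j. j + (n - k)"])
      (use lowest_pattern_entry[OF P low that] that in auto)
  define p where "p = n - i"
  have p: "n + 1 - (i + 1) = p" "n + 1 - i = Suc p" "n + 1 - (i - 1) = Suc (Suc p)" "1 \<le> p" "Suc p \<le> n"
    using i by (auto simp: p_def)
  have "row_sum P (i + 1) = P n p + row_sum P i" "row_sum P i = P n (Suc p) + row_sum P (i - 1)"
    using S[of "i + 1"] S[of i] S[of "i - 1"] p i sum.atLeast_Suc_atMost[of p n "P n"]
      sum.atLeast_Suc_atMost[of "Suc p" n "P n"] by auto
  then have "pattern_weight P i = P n (Suc p) - P n p"
    using i by (simp add: pattern_weight_row_sum)
  then show ?thesis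
    using GT_top_difference[OF P p(4), of "Suc p"] p by (simp add: p_def)
qed

section \<open>Dual patterns\<close>

lemma dual_pattern_apply:
  "dual_pattern n P i j = (if 1 \<le> j \<and> j \<le> i \<and> i \<le> n then P n 1 - P i (i + 1 - j) else 0)"
  by (simp add: dual_pattern_def)

text \<open>
  The condition on \<open>b\<close> is what the top row requires: its consecutive differences are those of the top row of
  \<open>P\<close> in reversed order.
\<close>

lemma dual_pattern_in_GT:
  assumes P: "P \<in> GT n a" and b: "\<And>i. 1 \<le> i \<Longrightarrow> i < n \<Longrightarrow> b i = a (n - i)"
  shows "dual_pattern n P \<in> GT n b"
  unfolding GT_iff
proof (intro conjI allI impI)
  fix k i assume "\<not> (1 \<le> i \<and> i \<le> k \<and> k \<le> n)"
  then show "dual_pattern n P k i = 0" unfolding dual_pattern_apply by auto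
next
  fix i assume i: "1 \<le> i" "i \<le> n"
  have "dual_pattern n P n i = int (\<Sum>m=1..<n+1-i. a m)"
    using GT_top_difference[OF P, of 1 "n + 1 - i"] i by (simp add: dual_pattern_apply)
  also have "(\<Sum>m=1..<n+1-i. a m) = (\<Sum>m=i..n-1. b m)"
    by (rule sum.reindex_bij_witness[of _ "\<lambda>m. n - m" "\<lambda>m. n - m"]) (use i in \<open>auto simp: b\<close>)
  finally show "dual_pattern n P n i = int (partition_of n b i)"
    by (simp add: partition_of_def)
next
  fix k i assume ki: "1 \<le> i" "i \<le> k" "k < n"
  then have *: "1 \<le> k + 1 - i" "k + 1 - i \<le> k" "Suc k + 1 - i = Suc (k + 1 - i)"
    "Suc k + 1 - Suc i = k + 1 - i" by auto
  show "dual_pattern n P k i \<le> dual_pattern n P (Suc k) i"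
    "dual_pattern n P (Suc k) (Suc i) \<le> dual_pattern n P k i"
    using GT_interlace[OF P, of k "k + 1 - i"] ki * by (simp_all add: dual_pattern_apply)
qed

lemma dual_pattern_involution:
  assumes "\<And>k i. \<not> (1 \<le> i \<and> i \<le> k \<and> k \<le> n) \<Longrightarrow> P k i = 0" and "P n n = 0"
  shows "dual_pattern n (dual_pattern n P) = P"
proof (intro ext)
  fix k i
  show "dual_pattern n (dual_pattern n P) k i = P k i"
  proof (cases "1 \<le> i \<and> i \<le> k \<and> k \<le> n")
    case True
    then have "k + 1 - (k + 1 - i) = i" "1 \<le> n" by auto
    then show ?thesis using True assms(2) by (auto simp: dual_pattern_apply)
  qed (use assms(1) in \<open>auto simp: dual_pattern_apply\<close>)
qed

lemma dual_pattern_add_entry: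
  assumes "1 \<le> i" "i \<le> k" "k < n"
  shows "dual_pattern n (add_entry P k i c) = add_entry (dual_pattern n P) k (k + 1 - i) (- c)"
proof (intro ext)
  fix m j
  have "m + 1 - j = i \<longleftrightarrow> j = k + 1 - i" if "m = k" "1 \<le> j" "j \<le> m" using that assms by auto
  then show "dual_pattern n (add_entry P k i c) m j = add_entry (dual_pattern n P) k (k + 1 - i) (- c) m j"
    using assms by (auto simp: dual_pattern_apply add_entry_apply)
qed

lemma dual_add_entry_in_GT_iff:
  assumes P: "P \<in> GT n a" and b: "\<And>i. 1 \<le> i \<Longrightarrow> i < n \<Longrightarrow> b i = a (n - i)"
    and ki: "1 \<le> i" "i \<le> k" "k < n"
  shows "dual_pattern n (add_entry P k i c) \<in> GT n b \<longleftrightarrow> add_entry P k i c \<in> GT n a"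
proof
  assume D: "dual_pattern n (add_entry P k i c) \<in> GT n b"
  have "dual_pattern n (dual_pattern n (add_entry P k i c)) = add_entry P k i c"
    by (rule dual_pattern_involution)
      (use GT_zero[OF P] GT_last_zero[OF P] ki in \<open>auto simp: add_entry_apply\<close>)
  moreover have "dual_pattern n (dual_pattern n (add_entry P k i c)) \<in> GT n a"
    by (rule dual_pattern_in_GT[OF D]) (use b in auto)
  ultimately show "add_entry P k i c \<in> GT n a" by simp
next
  assume "add_entry P k i c \<in> GT n a"
  then show "dual_pattern n (add_entry P k i c) \<in> GT n b"
    using b by (rule dual_pattern_in_GT)
qed

section \<open>Norms\<close>

text \<open>
  The Vandermonde product of the shifted entries of a row, each pair taken in the order that makes
  its factor positive.
\<close>

definition row_vandermonde :: "pattern \<Rightarrow> nat \<Rightarrow> int" where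
  "row_vandermonde P k = (\<Prod>(p, q)\<in>{(p, q). 1 \<le> p \<and> p < q \<and> q \<le> k}. shifted P k p - shifted P k q)"

lemma finite_index_pairs [simp]:
  "finite {(p, q). 1 \<le> p \<and> p < q \<and> q \<le> (k::nat)}" "finite {(p, q). 1 \<le> p \<and> p \<le> q \<and> q < (k::nat)}"
  "finite {(p, q). Suc 0 \<le> p \<and> p < q \<and> q \<le> (k::nat)}" "finite {(p, q). Suc 0 \<le> p \<and> p \<le> q \<and> q < (k::nat)}"
  by (rule finite_subset[of _ "{..k} \<times> {..k}"]; auto)+

lemma shifted_strict_decreasing:
  assumes "P \<in> GT n a" "1 \<le> i" "i < j" "j \<le> k" "k \<le> n"
  shows "shifted P k j < shifted P k i"
  using GT_row_decreasing[OF assms(1,2), of j k] assms by (simp add: shifted_def)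

lemma shifted_dual_pattern:
  assumes "1 \<le> i" "i \<le> k" "k \<le> n"
  shows "shifted (dual_pattern n P) k i = P n 1 - int k + 1 - shifted P k (k + 1 - i)"
  using assms by (simp add: shifted_def dual_pattern_apply)

lemma ifact_pos: "ifact z > 0"
  by (simp add: ifact_def)

lemma ifact_eq_mult: "z > 0 \<Longrightarrow> ifact z = of_int z * ifact (z - 1)"
proof -
  assume "z > 0"
  then have "nat z = Suc (nat (z - 1))" "real (Suc (nat (z - 1))) = of_int z" by auto
  then show ?thesis unfolding ifact_def by (simp only: fact_Suc of_nat_mult)
qed

lemma prod_weak_pairs:
  fixes f :: "nat \<Rightarrow> nat \<Rightarrow> 'a::comm_monoid_mult"
  assumes "\<And>p. f p p = 1"
  shows "(\<Prod>(p, q)\<in>{(p, q). 1 \<le> p \<and> p \<le> q \<and> q < t}. f p q) =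
    (\<Prod>(p, q)\<in>{(p, q). 1 \<le> p \<and> p < q \<and> q \<le> t - 1}. f p q)"
proof (rule prod.mono_neutral_right)
  let ?W = "{(p, q). 1 \<le> p \<and> p \<le> q \<and> q < t}" and ?S = "{(p, q). 1 \<le> p \<and> p < q \<and> q \<le> t - 1}"
  show "\<forall>x\<in>?W - ?S. (case x of (p, q) \<Rightarrow> f p q) = 1"
  proof
    fix x assume x: "x \<in> ?W - ?S"
    obtain p q where pq: "x = (p, q)" by (cases x)
    have "p = q" using x unfolding pq by auto
    then show "(case x of (p, q) \<Rightarrow> f p q) = 1" using assms by (simp add: pq)
  qed
qed auto

text \<open>The contribution of two adjacent rows to \<open>\<parallel>P\<parallel>\<^sup>2\<close>, as a function of the shifted entries.\<close>

definition norm_factor :: "pattern \<Rightarrow> nat \<Rightarrow> real" where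
  "norm_factor l t = (\<Prod>(p, q)\<in>{(p, q). 1 \<le> p \<and> p \<le> q \<and> q < t}.
        ifact (l t p - l (t-1) q) / ifact (l (t-1) p - l (t-1) q)) *
     (\<Prod>(p, q)\<in>{(p, q). 1 \<le> p \<and> p < q \<and> q \<le> t}.
        ifact (l t p - l t q - 1) / ifact (l (t-1) p - l t q - 1))"

lemma pattern_norm_eq: "pattern_norm n P = sqrt (\<Prod>t=2..n. norm_factor (shifted P) t)"
  unfolding pattern_norm_def norm_factor_def Let_def by (rule refl)

text \<open>
  Passing to the dual pattern exchanges the two kinds of mixed factors, in numerator and
  denominator, and preserves the other ones.  So in \<open>\<parallel>P\<parallel>\<^sup>2 \<parallel>P\<^sup>*\<parallel>\<^sup>2\<close> the mixed factors cancel,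
  and the others occur twice.
\<close>

lemma norm_factor_mult_dual:
  fixes P :: pattern
  assumes t: "1 \<le> t" "t \<le> n"
  defines "l \<equiv> shifted P"
  shows "norm_factor l t * norm_factor (shifted (dual_pattern n P)) t =
    ((\<Prod>(p, q)\<in>{(p, q). 1 \<le> p \<and> p < q \<and> q \<le> t}. ifact (l t p - l t q - 1)) /
     (\<Prod>(p, q)\<in>{(p, q). 1 \<le> p \<and> p < q \<and> q \<le> t - 1}. ifact (l (t-1) p - l (t-1) q)))\<^sup>2"
proof -
  define m where "m = shifted (dual_pattern n P)"
  define A B C D where
    "A = (\<lambda>l. \<Prod>(p, q)\<in>{(p, q). 1 \<le> p \<and> p \<le> q \<and> q < t}. ifact (l t p - l (t-1) q))" and
    "B = (\<lambda>l. \<Prod>(p, q)\<in>{(p, q). 1 \<le> p \<and> p \<le> q \<and> q < t}. ifact (l (t-1) p - l (t-1) q))" and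
    "C = (\<lambda>l. \<Prod>(p, q)\<in>{(p, q). 1 \<le> p \<and> p < q \<and> q \<le> t}. ifact (l t p - l t q - 1))" and
    "D = (\<lambda>l. \<Prod>(p, q)\<in>{(p, q). 1 \<le> p \<and> p < q \<and> q \<le> t}. ifact (l (t-1) p - l t q - 1))"
  have F: "norm_factor l t = A l / B l * (C l / D l)" for l
    unfolding norm_factor_def A_def B_def C_def D_def
    by (simp add: case_prod_unfold prod_dividef)
  have m1: "m t i = P n 1 - int t + 1 - l t (t + 1 - i)" if "1 \<le> i" "i \<le> t" for i
    using shifted_dual_pattern that t by (simp add: l_def m_def)
  have m2: "m (t - Suc 0) i = P n 1 - int t + 2 - l (t - 1) (t - i)" if "1 \<le> i" "i < t" for i
    using shifted_dual_pattern[of i "t - Suc 0" n P] that t by (simp add: l_def m_def of_nat_diff)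
  have AD: "A m = D l"
    unfolding A_def D_def
    by (rule prod.reindex_bij_witness[of _ "\<lambda>(p, q). (t + 1 - q, t - p)" "\<lambda>(p, q). (t - q, t + 1 - p)"])
      (auto simp: m1 m2 algebra_simps)
  have DA: "D m = A l"
    unfolding A_def D_def
    by (rule prod.reindex_bij_witness[of _ "\<lambda>(p, q). (t - q, t + 1 - p)" "\<lambda>(p, q). (t + 1 - q, t - p)"])
      (auto simp: m1 m2 algebra_simps)
  have BB: "B m = B l"
    unfolding B_def
    by (rule prod.reindex_bij_witness[of _ "\<lambda>(p, q). (t - q, t - p)" "\<lambda>(p, q). (t - q, t - p)"])
      (auto simp: m2 algebra_simps)
  have CC: "C m = C l"
    unfolding C_def
    by (rule prod.reindex_bij_witness[of _ "\<lambda>(p, q). (t + 1 - q, t + 1 - p)" "\<lambda>(p, q). (t + 1 - q, t + 1 - p)"])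
      (auto simp: m1 algebra_simps)
  have B: "B l = (\<Prod>(p, q)\<in>{(p, q). 1 \<le> p \<and> p < q \<and> q \<le> t - 1}. ifact (l (t-1) p - l (t-1) q))"
    unfolding B_def by (rule prod_weak_pairs) (simp add: ifact_def)
  have "A l > 0" "D l > 0"
    by (auto simp: A_def D_def intro!: prod_pos ifact_pos)
  then have "norm_factor l t * norm_factor m t = (C l / B l)\<^sup>2"
    by (simp add: F AD DA BB CC power2_eq_square)
  then show ?thesis by (simp add: B C_def m_def)
qed

text \<open>
  Up to the factors \<open>(l\<^bsub>k,p\<^esub> - l\<^bsub>k,q\<^esub>)! / (l\<^bsub>k,p\<^esub> - l\<^bsub>k,q\<^esub> - 1)! = l\<^bsub>k,p\<^esub> - l\<^bsub>k,q\<^esub>\<close>, the denominator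
  for \<open>t = k + 1\<close> is the numerator for \<open>t = k\<close>, so the product over \<open>t\<close> telescopes.
\<close>

lemma pattern_norm_mult_dual:
  assumes P: "P \<in> GT n a"
  shows "pattern_norm n P * pattern_norm n (dual_pattern n P) =
    (\<Prod>(p, q)\<in>{(p, q). 1 \<le> p \<and> p < q \<and> q \<le> n}. ifact (shifted P n p - shifted P n q - 1)) /
    of_int (\<Prod>k=1..n-1. row_vandermonde P k)"
proof -
  define l where "l = shifted P"
  define X where "X = (\<lambda>k. \<Prod>(p, q)\<in>{(p, q). 1 \<le> p \<and> p < q \<and> q \<le> k}. ifact (l k p - l k q - 1))"
  define Y where "Y = (\<lambda>k. \<Prod>(p, q)\<in>{(p, q). 1 \<le> p \<and> p < q \<and> q \<le> k}. ifact (l k p - l k q))"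
  have pos: "X k > 0" "Y k > 0" for k
    by (auto simp: X_def Y_def intro!: prod_pos ifact_pos)
  have Y: "Y k = of_int (row_vandermonde P k) * X k" if "k \<le> n" for k
  proof -
    have "Y k = (\<Prod>(p, q)\<in>{(p, q). 1 \<le> p \<and> p < q \<and> q \<le> k}. of_int (l k p - l k q) * ifact (l k p - l k q - 1))"
      unfolding Y_def
      by (rule prod.cong) (use shifted_strict_decreasing[OF P] that in \<open>auto simp: l_def simp del: of_int_diff intro!: ifact_eq_mult\<close>)
    also have "\<dots> = of_int (row_vandermonde P k) * X k"
      by (simp add: row_vandermonde_def X_def l_def case_prod_unfold prod.distrib of_int_prod)
    finally show ?thesis .
  qed
  have "pattern_norm n P * pattern_norm n (dual_pattern n P) =
      sqrt (\<Prod>t=2..n. norm_factor l t * norm_factor (shifted (dual_pattern n P)) t)"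
    by (simp add: pattern_norm_eq real_sqrt_mult prod.distrib l_def)
  also have "(\<Prod>t=2..n. norm_factor l t * norm_factor (shifted (dual_pattern n P)) t) =
      (\<Prod>t=2..n. (X t / Y (t - 1))\<^sup>2)"
    unfolding X_def Y_def l_def by (rule prod.cong[OF refl], rule norm_factor_mult_dual) auto
  also have "sqrt \<dots> = (\<Prod>t=2..n. X t / Y (t - 1))"
    unfolding prod_power_distrib[where n = 2, symmetric]
    by (rule real_sqrt_unique[OF refl]) (intro prod_nonneg divide_nonneg_nonneg ballI less_imp_le[OF pos(1)] less_imp_le[OF pos(2)])
  also have "\<dots> = X n / of_int (\<Prod>k=1..n-1. row_vandermonde P k)" if "n \<ge> 1"
  proof -
    have "m \<le> n \<Longrightarrow> (\<Prod>t=2..m. X t / Y (t - 1)) = X m / of_int (\<Prod>k=1..m-1. row_vandermonde P k)"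
      if "m \<ge> 1" for m
      using that
    proof (induction m rule: dec_induct)
      case base
      have "X 1 = 1" unfolding X_def by (rule prod.neutral) auto
      then show ?case by simp
    next
      case (step m)
      let ?R = "\<lambda>m. of_int (\<Prod>k=1..m. row_vandermonde P k) :: real"
      have XY: "X m / Y m = 1 / of_int (row_vandermonde P m)"
        using pos(1)[of m] step.prems by (simp add: Y)
      have R: "?R m = ?R (m - 1) * of_int (row_vandermonde P m)"
        using step.hyps by (cases m) auto
      have "(\<Prod>t=2..Suc m. X t / Y (t - 1)) = (\<Prod>t=2..m. X t / Y (t - 1)) * (X (Suc m) / Y m)"
        using step.hyps by simp
      also have "\<dots> = X (Suc m) / ?R (m - 1) * (X m / Y m)"
        using step.IH step.prems by simp
      also have "\<dots> = X (Suc m) / ?R m"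
        unfolding XY R by simp
      finally show ?case by simp
    qed
    then show ?thesis using that by simp
  qed
  finally show ?thesis
  proof (cases "n \<ge> 1")
    case False
    then have "n = 0" by simp
    moreover have "X 0 = 1" unfolding X_def by (rule prod.neutral) auto
    ultimately show ?thesis by (simp add: pattern_norm_eq X_def l_def)
  qed (auto simp: X_def l_def)
qed

text \<open>The sign counts the pairs in which the given entry comes second.\<close>

lemma row_vandermonde_split:
  assumes "1 \<le> i" "i \<le> k"
  shows "row_vandermonde P k =
    (\<Prod>(p, q)\<in>{(p, q). 1 \<le> p \<and> p < q \<and> q \<le> k \<and> p \<noteq> i \<and> q \<noteq> i}. shifted P k p - shifted P k q) *
    ((-1) ^ (i - 1) * (\<Prod>q\<in>{1..k} - {i}. shifted P k i - shifted P k q))"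
proof -
  let ?f = "\<lambda>(p, q). shifted P k p - shifted P k q"
  let ?A = "{(p, q). 1 \<le> p \<and> p < q \<and> q \<le> k}"
  let ?R = "{(p, q). 1 \<le> p \<and> p < q \<and> q \<le> k \<and> p \<noteq> i \<and> q \<noteq> i}"
  have A: "?A = ?R \<union> ((\<lambda>p. (p, i)) ` {1..<i} \<union> Pair i ` {i<..k})" using assms by auto
  have fin: "finite ?R" by (rule finite_subset[OF _ finite_index_pairs(1)[of k]]) auto
  have "prod ?f ?A = prod ?f ?R * prod ?f ((\<lambda>p. (p, i)) ` {1..<i} \<union> Pair i ` {i<..k})"
    unfolding A by (rule prod.union_disjoint) (use fin in auto)
  also have "prod ?f ((\<lambda>p. (p, i)) ` {1..<i} \<union> Pair i ` {i<..k}) =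
      prod ?f ((\<lambda>p. (p, i)) ` {1..<i}) * prod ?f (Pair i ` {i<..k})"
    by (rule prod.union_disjoint) auto
  also have "prod ?f ((\<lambda>p. (p, i)) ` {1..<i}) = (\<Prod>p=1..<i. - 1 * (shifted P k i - shifted P k p))"
    by (subst prod.reindex) (auto simp: inj_on_def)
  also have "\<dots> = (-1) ^ (i - 1) * (\<Prod>p=1..<i. shifted P k i - shifted P k p)"
    by (subst prod.distrib) simp
  also have "prod ?f (Pair i ` {i<..k}) = (\<Prod>q\<in>{i<..k}. shifted P k i - shifted P k q)"
    by (subst prod.reindex) (auto simp: inj_on_def)
  also have "(-1) ^ (i - 1) * (\<Prod>p=1..<i. shifted P k i - shifted P k p) *
        (\<Prod>q\<in>{i<..k}. shifted P k i - shifted P k q) =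
      (-1) ^ (i - 1) * (\<Prod>q\<in>{1..<i} \<union> {i<..k}. shifted P k i - shifted P k q)"
    by (subst prod.union_disjoint) auto
  also have "{1..<i} \<union> {i<..k} = {1..k} - {i}" using assms by auto
  finally show ?thesis by (simp add: row_vandermonde_def)
qed

lemma shifted_add_entry:
  "shifted (add_entry P k i c) m j = shifted P m j + (if m = k \<and> j = i then c else 0)"
  by (simp add: shifted_def add_entry_apply)

lemma row_vandermonde_add_entry:
  assumes "1 \<le> i" "i \<le> k"
  shows "row_vandermonde (add_entry P k i c) k * (\<Prod>q\<in>{1..k} - {i}. shifted P k i - shifted P k q) =
    row_vandermonde P k * (\<Prod>q\<in>{1..k} - {i}. shifted P k i + c - shifted P k q)"
proof -
  have "(\<Prod>(p, q)\<in>{(p, q). 1 \<le> p \<and> p < q \<and> q \<le> k \<and> p \<noteq> i \<and> q \<noteq> i}.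
        shifted (add_entry P k i c) k p - shifted (add_entry P k i c) k q) =
      (\<Prod>(p, q)\<in>{(p, q). 1 \<le> p \<and> p < q \<and> q \<le> k \<and> p \<noteq> i \<and> q \<noteq> i}. shifted P k p - shifted P k q)"
    by (rule prod.cong) (auto simp: shifted_add_entry)
  moreover have "(\<Prod>q\<in>{1..k} - {i}. shifted (add_entry P k i c) k i - shifted (add_entry P k i c) k q) =
      (\<Prod>q\<in>{1..k} - {i}. shifted P k i + c - shifted P k q)"
    by (rule prod.cong) (auto simp: shifted_add_entry)
  ultimately show ?thesis
    by (simp only: row_vandermonde_split[OF assms, of P] row_vandermonde_split[OF assms, of "add_entry P k i c"] mult_ac)
qed

lemma row_vandermonde_add_entry_other:
  "m \<noteq> k \<Longrightarrow> row_vandermonde (add_entry P k i c) m = row_vandermonde P m"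
  by (simp add: row_vandermonde_def shifted_add_entry)

section \<open>The coefficients of the invariant\<close>

definition F_coeff :: "nat \<Rightarrow> (nat \<Rightarrow> nat) \<Rightarrow> pattern \<Rightarrow> complex" where
  "F_coeff n a P = complex_of_real ((-1) powi level n a P /
     (pattern_norm n P * pattern_norm n (dual_pattern n P)))"

text \<open>
  The sign comes from the level, the products from the only Vandermonde product that changes; the
  equation is stated without quotients.
\<close>

lemma F_coeff_add_entry:
  assumes P: "P \<in> GT n a" and Q: "add_entry P k i c \<in> GT n a"
    and ki: "1 \<le> i" "i \<le> k" "k < n" and c: "c = 1 \<or> c = -1"
  shows "F_coeff n a (add_entry P k i c) * of_int (\<Prod>q\<in>{1..k} - {i}. shifted P k i - shifted P k q) =
    - F_coeff n a P * of_int (\<Prod>q\<in>{1..k} - {i}. shifted P k i + c - shifted P k q)"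
proof -
  let ?Q = "add_entry P k i c"
  define K where "K = (\<Prod>(p, q)\<in>{(p, q). 1 \<le> p \<and> p < q \<and> q \<le> n}. ifact (shifted P n p - shifted P n q - 1))"
  define R where "R = (\<Prod>m\<in>{1..n-1} - {k}. row_vandermonde P m)"
  have R: "(\<Prod>m=1..n-1. row_vandermonde P m) = row_vandermonde P k * R"
    unfolding R_def using ki by (subst prod.remove[of _ k]) auto
  have "(\<Prod>m=1..n-1. row_vandermonde ?Q m) = row_vandermonde ?Q k * (\<Prod>m\<in>{1..n-1} - {k}. row_vandermonde ?Q m)"
    using ki by (subst prod.remove[of _ k]) auto
  also have "(\<Prod>m\<in>{1..n-1} - {k}. row_vandermonde ?Q m) = R"
    unfolding R_def by (rule prod.cong) (auto simp: row_vandermonde_add_entry_other)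
  finally have R': "(\<Prod>m=1..n-1. row_vandermonde ?Q m) = row_vandermonde ?Q k * R" .
  have K': "(\<Prod>(p, q)\<in>{(p, q). 1 \<le> p \<and> p < q \<and> q \<le> n}. ifact (shifted ?Q n p - shifted ?Q n q - 1)) = K"
    unfolding K_def using ki by (simp add: shifted_add_entry)
  have sign: "(-1 :: real) powi level n a ?Q = - ((-1) powi level n a P)"
    unfolding level_add_entry[OF P Q ki] using c by (auto simp: power_int_diff power_int_add)
  have 1: "F_coeff n a P = of_real ((-1) powi level n a P / K) * of_int (row_vandermonde P k * R)"
    unfolding F_coeff_def pattern_norm_mult_dual[OF P] R K_def[symmetric] by simp
  have 2: "F_coeff n a ?Q = - of_real ((-1) powi level n a P / K) * of_int (row_vandermonde ?Q k * R)"
    unfolding F_coeff_def pattern_norm_mult_dual[OF Q] R' K' sign by simp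
  have cancel: "- s * (v' * r) * x = - (s * (v * r)) * y" if "v' * x = v * y" for s v v' r x y :: complex
  proof -
    have "- s * (v' * r) * x = - s * r * (v' * x)" by simp
    also have "\<dots> = - (s * (v * r)) * y" unfolding that by simp
    finally show ?thesis .
  qed
  show ?thesis
    unfolding 1 2 of_int_mult
    by (rule cancel) (simp only: of_int_mult[symmetric] row_vandermonde_add_entry[OF ki(1,2)])
qed

lemma shifted_dual_add_entry:
  assumes "1 \<le> i" "i \<le> k" "k < n" "1 \<le> q" "q \<le> m" "m \<le> n"
  shows "shifted (dual_pattern n (add_entry P k i c)) m q =
    P n 1 - int m + 1 - shifted P m (m + 1 - q) - (if m = k \<and> q = k + 1 - i then c else 0)"
  using assms by (simp add: dual_pattern_add_entry shifted_add_entry shifted_dual_pattern)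

lemma dual_denominator:
  fixes P :: pattern and c :: int
  assumes "1 \<le> i" "i \<le> k" "k < n"
  defines "m \<equiv> shifted (dual_pattern n (add_entry P k i c))"
  shows "(\<Prod>q\<in>{1..k} - {k + 1 - i}. m k (k + 1 - i) - m k q) =
    (-1) ^ (k - 1) * (\<Prod>q\<in>{1..k} - {i}. shifted P k i + c - shifted P k q)"
proof -
  have "(\<Prod>q\<in>{1..k} - {k + 1 - i}. m k (k + 1 - i) - m k q) =
      (\<Prod>q\<in>{1..k} - {i}. - 1 * (shifted P k i + c - shifted P k q))"
    by (rule prod.reindex_bij_witness[of _ "\<lambda>q. k + 1 - q" "\<lambda>q. k + 1 - q"])
      (use assms(1-3) in \<open>auto simp: m_def shifted_dual_add_entry\<close>)
  also have "\<dots> = (-1) ^ (k - 1) * (\<Prod>q\<in>{1..k} - {i}. shifted P k i + c - shifted P k q)"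
    unfolding prod.distrib using assms(1-3) by (simp add: card_Diff_subset)
  finally show ?thesis .
qed

text \<open>
  Duality negates the differences of shifted entries.  The signs of numerator and denominator
  agree, as these have \<open>k + 1\<close> and \<open>k - 1\<close> factors (and \<open>k - 1\<close> each in the case of \<open>Y\<^sub>k\<close>).  The matrix
  coefficient therefore has the same numerator as the one for \<open>P\<close>, and its denominator is
  centred at the raised entry.
\<close>

lemma dual_raising_coeff:
  assumes "1 \<le> i" "i \<le> k" "k < n"
  shows "raising_coeff (dual_pattern n (add_entry P k i 1)) k (k + 1 - i) =
    of_int (- (\<Prod>q=1..k+1. shifted P k i - shifted P (k+1) q)) /
    of_int (\<Prod>q\<in>{1..k} - {i}. shifted P k i + 1 - shifted P k q)"
proof -
  let ?m = "shifted (dual_pattern n (add_entry P k i 1))"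
  have "(\<Prod>q=1..k+1. ?m k (k + 1 - i) - ?m (k+1) q) =
      (\<Prod>q=1..k+1. - 1 * (shifted P k i - shifted P (k+1) q))"
    by (rule prod.reindex_bij_witness[of _ "\<lambda>q. k + 2 - q" "\<lambda>q. k + 2 - q"])
      (use assms(1-3) in \<open>auto simp: shifted_dual_add_entry numeral_2_eq_2\<close>)
  also have "\<dots> = (-1) ^ (k + 1) * (\<Prod>q=1..k+1. shifted P k i - shifted P (k+1) q)"
    unfolding prod.distrib by simp
  also have "(-1 :: int) ^ (k + 1) = (-1) ^ (k - 1)"
    using assms by (simp add: minus_one_power_iff)
  finally show ?thesis
    unfolding raising_coeff_def Let_def dual_denominator[OF assms]
    by (simp only: minus_one_power_iff split: if_splits) auto
qed

lemma dual_lowering_coeff: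
  assumes "1 \<le> i" "i \<le> k" "k < n"
  shows "lowering_coeff (dual_pattern n (add_entry P k i (-1))) k (k + 1 - i) =
    of_int (\<Prod>q=1..k-1. shifted P k i - shifted P (k-1) q) /
    of_int (\<Prod>q\<in>{1..k} - {i}. shifted P k i + (-1) - shifted P k q)"
proof -
  let ?m = "shifted (dual_pattern n (add_entry P k i (-1)))"
  have "(\<Prod>q=1..k-1. ?m k (k + 1 - i) - ?m (k-1) q) =
      (\<Prod>q=1..k-1. - 1 * (shifted P k i - shifted P (k-1) q))"
    by (rule prod.reindex_bij_witness[of _ "\<lambda>q. k - q" "\<lambda>q. k - q"])
      (use assms(1-3) in \<open>auto simp: shifted_dual_add_entry of_nat_diff\<close>)
  also have "\<dots> = (-1) ^ (k - 1) * (\<Prod>q=1..k-1. shifted P k i - shifted P (k-1) q)"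
    unfolding prod.distrib by simp
  finally show ?thesis
    unfolding lowering_coeff_def Let_def dual_denominator[OF assms]
    by (simp only: minus_one_power_iff split: if_splits) auto
qed

lemma cancel_by_ratio:
  fixes x y N d d' :: complex
  assumes "y * d = - x * d'" "d \<noteq> 0" "d' \<noteq> 0"
  shows "x * (N / d) + y * (N / d') = 0"
proof -
  have y: "y = - x * d' / d" using assms by (simp add: field_simps)
  show ?thesis unfolding y using assms(2,3) by (simp add: field_simps)
qed

lemma denominators_nonzero:
  assumes P: "P \<in> GT n a" and Q: "add_entry P k i c \<in> GT n a" and ki: "1 \<le> i" "i \<le> k" "k < n"
  shows "(\<Prod>q\<in>{1..k} - {i}. shifted P k i - shifted P k q) \<noteq> 0"
    and "(\<Prod>q\<in>{1..k} - {i}. shifted P k i + c - shifted P k q) \<noteq> 0"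
proof -
  have ne: "shifted R k i \<noteq> shifted R k q" if "R \<in> GT n a" "q \<in> {1..k} - {i}" for R q
    using shifted_strict_decreasing[OF that(1), of i q k] shifted_strict_decreasing[OF that(1), of q i k] that(2) ki
    by (cases "i < q") auto
  show "(\<Prod>q\<in>{1..k} - {i}. shifted P k i - shifted P k q) \<noteq> 0"
    using ne[OF P] by (auto simp: prod_zero_iff)
  show "(\<Prod>q\<in>{1..k} - {i}. shifted P k i + c - shifted P k q) \<noteq> 0"
    using ne[OF Q] by (auto simp: prod_zero_iff shifted_add_entry)
qed

text \<open>
  Interlacing puts the shifted entries of row \<open>k + 1\<close> strictly above or strictly below \<open>l\<^bsub>k,i\<^esub>\<close>: the ones
  with \<open>q \<le> i\<close> because the entry can still be raised, the others because of the shift.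
\<close>

lemma raising_coeff_nonzero:
  assumes P: "P \<in> GT n a" and Q: "add_entry P k i 1 \<in> GT n a" and ki: "1 \<le> i" "i \<le> k" "k < n"
  shows "raising_coeff P k i \<noteq> 0"
proof -
  have "shifted P k i \<noteq> shifted P (k + 1) q" if q: "q \<in> {1..k + 1}" for q
  proof (cases "q \<le> i")
    case True
    have "P k i + 1 \<le> P (k + 1) i"
      using GT_interlace(1)[OF Q, of k i] ki by (simp add: add_entry_apply)
    moreover have "P (k + 1) i \<le> P (k + 1) q"
      using GT_row_decreasing[OF P, of q i "k + 1"] True q ki by simp
    ultimately show ?thesis using True by (simp add: shifted_def)
  next
    case False
    have "P (k + 1) (i + 1) \<le> P k i"
      using GT_interlace(2)[OF P, of k i] ki by simp
    moreover have "P (k + 1) q \<le> P (k + 1) (i + 1)"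
      using GT_row_decreasing[OF P, of "i + 1" q "k + 1"] False q ki by simp
    ultimately show ?thesis using False by (simp add: shifted_def)
  qed
  then have "(\<Prod>q=1..k+1. shifted P k i - shifted P (k+1) q) \<noteq> 0"
    by (auto simp: prod_zero_iff simp del: prod.cl_ivl_Suc)
  then show ?thesis
    using denominators_nonzero(1)[OF assms]
    by (simp add: raising_coeff_def Let_def del: of_int_prod prod.cl_ivl_Suc of_int_diff prod_zero_iff)
qed

lemma F_coeff_raising:
  assumes P: "P \<in> GT n a" and Q: "add_entry P k i 1 \<in> GT n a" and ki: "1 \<le> i" "i \<le> k" "k < n"
  shows "F_coeff n a P * raising_coeff P k i +
    F_coeff n a (add_entry P k i 1) * raising_coeff (dual_pattern n (add_entry P k i 1)) k (k + 1 - i) = 0"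
  unfolding dual_raising_coeff[OF ki] raising_coeff_def[of P] Let_def
  by (rule cancel_by_ratio[OF F_coeff_add_entry[OF assms disjI1[OF refl]]])
    (simp_all only: of_int_eq_0_iff denominators_nonzero[OF assms] not_False_eq_True)

lemma F_coeff_lowering:
  assumes P: "P \<in> GT n a" and Q: "add_entry P k i (-1) \<in> GT n a" and ki: "1 \<le> i" "i \<le> k" "k < n"
  shows "F_coeff n a P * lowering_coeff P k i +
    F_coeff n a (add_entry P k i (-1)) * lowering_coeff (dual_pattern n (add_entry P k i (-1))) k (k + 1 - i) = 0"
  unfolding dual_lowering_coeff[OF ki] lowering_coeff_def[of P] Let_def
  by (rule cancel_by_ratio[OF F_coeff_add_entry[OF assms disjI2[OF refl]]])
    (simp_all only: of_int_eq_0_iff denominators_nonzero[OF assms] not_False_eq_True)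

text \<open>
  Here \<open>u\<close> and \<open>w\<close> stand for coordinates of the images of the two bases under arbitrary linear maps,
  so that the identity can be used at every point of a one-parameter subgroup.  The terms of the
  sum pair off: the first part of the term for \<open>P\<close> and \<open>i\<close> cancels the second part of the one for
  \<open>P \<plusminus> \<delta>\<^bsub>k,i\<^esub>\<close>.
\<close>

lemma paired_sum_vanishes:
  fixes u w :: "pattern \<Rightarrow> complex" and f :: "pattern \<Rightarrow> complex" and C :: "pattern \<Rightarrow> nat \<Rightarrow> nat \<Rightarrow> complex"
  assumes fin: "finite (GT n a)"
    and b: "\<And>i. 1 \<le> i \<Longrightarrow> i < n \<Longrightarrow> b i = a (n - i)" and k: "1 \<le> k" "k < n"
    and cancel: "\<And>P i. P \<in> GT n a \<Longrightarrow> add_entry P k i c \<in> GT n a \<Longrightarrow> 1 \<le> i \<Longrightarrow> i \<le> k \<Longrightarrow>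
      f P * C P k i + f (add_entry P k i c) * C (dual_pattern n (add_entry P k i c)) k (k + 1 - i) = 0"
  shows "(\<Sum>P\<in>GT n a. f P *
      ((\<Sum>i=1..k. if add_entry P k i c \<in> GT n a then C P k i * u (add_entry P k i c) else 0) * w (dual_pattern n P) +
       u P * (\<Sum>j=1..k. if add_entry (dual_pattern n P) k j c \<in> GT n b
          then C (dual_pattern n P) k j * w (add_entry (dual_pattern n P) k j c) else 0))) = 0"
proof -
  let ?S = "GT n a" and ?d = "dual_pattern n"
  define A where "A = (\<lambda>P i. f P * C P k i * u (add_entry P k i c) * w (?d P))"
  define B where "B = (\<lambda>P i. f P * C (?d P) k (k + 1 - i) * u P * w (?d (add_entry P k i (- c))))"
  have dual_sum: "(\<Sum>j=1..k. if add_entry (?d P) k j c \<in> GT n b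
      then C (?d P) k j * w (add_entry (?d P) k j c) else 0) =
    (\<Sum>i=1..k. if add_entry P k i (- c) \<in> ?S
      then C (?d P) k (k + 1 - i) * w (?d (add_entry P k i (- c))) else 0)" if P: "P \<in> ?S" for P
  proof (rule sum.reindex_bij_witness[of _ "\<lambda>i. k + 1 - i" "\<lambda>i. k + 1 - i"])
    fix j assume j: "j \<in> {1..k}"
    then have i: "1 \<le> k + 1 - j" "k + 1 - j \<le> k" "k + 1 - (k + 1 - j) = j" by auto
    show "(if add_entry P k (k + 1 - j) (- c) \<in> ?S
        then C (?d P) k (k + 1 - (k + 1 - j)) * w (?d (add_entry P k (k + 1 - j) (- c))) else 0) =
      (if add_entry (?d P) k j c \<in> GT n b then C (?d P) k j * w (add_entry (?d P) k j c) else 0)"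
      using dual_add_entry_in_GT_iff[OF P b i(1,2) k(2), of "- c"]
      unfolding dual_pattern_add_entry[OF i(1,2) k(2), of P "- c"] i(3) by simp
  qed auto
  have "(\<Sum>P\<in>?S. f P *
      ((\<Sum>i=1..k. if add_entry P k i c \<in> ?S then C P k i * u (add_entry P k i c) else 0) * w (?d P) +
       u P * (\<Sum>j=1..k. if add_entry (?d P) k j c \<in> GT n b
          then C (?d P) k j * w (add_entry (?d P) k j c) else 0))) =
    (\<Sum>P\<in>?S. \<Sum>i=1..k. (if add_entry P k i c \<in> ?S then A P i else 0) +
      (if add_entry P k i (- c) \<in> ?S then B P i else 0))"
    by (rule sum.cong[OF refl], subst dual_sum, assumption)
      (simp add: sum.distrib distrib_left sum_distrib_left sum_distrib_right A_def B_def mult_ac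
        if_distrib[of "\<lambda>x. _ * x"] cong: if_cong)
  also have "\<dots> = (\<Sum>i=1..k. (\<Sum>P\<in>{P\<in>?S. add_entry P k i c \<in> ?S}. A P i) +
      (\<Sum>P\<in>{P\<in>?S. add_entry P k i (- c) \<in> ?S}. B P i))"
    by (subst sum.swap) (simp add: sum.distrib sum.inter_filter fin)
  also have "\<dots> = (\<Sum>i=1..k. 0)"
  proof (rule sum.cong[OF refl])
    fix i assume i: "i \<in> {1..k}"
    have "(\<Sum>P\<in>{P\<in>?S. add_entry P k i (- c) \<in> ?S}. B P i) =
        (\<Sum>P\<in>{P\<in>?S. add_entry P k i c \<in> ?S}. B (add_entry P k i c) i)"
      by (rule sum.reindex_bij_witness[of _ "\<lambda>P. add_entry P k i c" "\<lambda>P. add_entry P k i (- c)"]) auto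
    then have "(\<Sum>P\<in>{P\<in>?S. add_entry P k i c \<in> ?S}. A P i) + (\<Sum>P\<in>{P\<in>?S. add_entry P k i (- c) \<in> ?S}. B P i) =
        (\<Sum>P\<in>{P\<in>?S. add_entry P k i c \<in> ?S}. A P i + B (add_entry P k i c) i)"
      by (simp add: sum.distrib)
    also have "\<dots> = 0"
    proof (rule sum.neutral, rule ballI)
      fix P assume P: "P \<in> {P \<in> ?S. add_entry P k i c \<in> ?S}"
      have "A P i + B (add_entry P k i c) i =
          (f P * C P k i + f (add_entry P k i c) * C (?d (add_entry P k i c)) k (k + 1 - i)) *
          (u (add_entry P k i c) * w (?d P))"
        unfolding A_def B_def add_entry_cancel by (simp only: algebra_simps)
      then show "A P i + B (add_entry P k i c) i = 0" using cancel[of P i] P i by simp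
    qed
    finally show "(\<Sum>P\<in>{P\<in>?S. add_entry P k i c \<in> ?S}. A P i) +
      (\<Sum>P\<in>{P\<in>?S. add_entry P k i (- c) \<in> ?S}. B P i) = 0" .
  qed
  finally show ?thesis by simp
qed

section \<open>Generation of the special linear group\<close>

lemma addrow_mat_commutator:
  fixes a b :: "'a :: comm_ring_1"
  assumes "k < n" "l < n" "m < n" "k \<noteq> l" "l \<noteq> m" "k \<noteq> m"
  shows "addrow_mat n a k l * (addrow_mat n b l m * (addrow_mat n (- a) k l * addrow_mat n (- b) l m)) =
    addrow_mat n (a * b) k m"
proof -
  have 1: "addrow_mat n (- a) k l * addrow_mat n (- b) l m = addrow (- a) k l (addrow_mat n (- b) l m)"
    by (rule addrow_mat[symmetric]) (use assms in auto)
  have 2: "addrow_mat n b l m * (addrow (- a) k l (addrow_mat n (- b) l m)) =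
      addrow b l m (addrow (- a) k l (addrow_mat n (- b) l m))"
    by (rule addrow_mat[symmetric]) (use assms in auto)
  have 3: "addrow_mat n a k l * (addrow b l m (addrow (- a) k l (addrow_mat n (- b) l m))) =
      addrow a k l (addrow b l m (addrow (- a) k l (addrow_mat n (- b) l m)))"
    by (rule addrow_mat[symmetric]) (use assms in auto)
  show ?thesis
    unfolding 1 2 3
    by (rule eq_matI) (use assms in \<open>auto simp: algebra_simps\<close>)
qed

text \<open>
  Gaussian elimination: if the first \<open>m\<close> rows and columns are those of the identity matrix, then
  row and column operations achieve the same for row and column \<open>m\<close>.  The entry in position
  \<open>(m, m)\<close> is turned into 1 with the help of a nonzero entry below it; such an entry can be
  created unless \<open>m\<close> is the last index, in which case the determinant already is that entry.
\<close>

lemma SL_induct_elementary: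
  fixes H :: "'a :: field mat \<Rightarrow> bool"
  assumes one: "H (1\<^sub>m n)"
    and mult: "\<And>A B. A \<in> carrier_mat n n \<Longrightarrow> B \<in> carrier_mat n n \<Longrightarrow> det A = 1 \<Longrightarrow> det B = 1 \<Longrightarrow>
      H A \<Longrightarrow> H B \<Longrightarrow> H (A * B)"
    and elem: "\<And>s k l. k < n \<Longrightarrow> l < n \<Longrightarrow> k \<noteq> l \<Longrightarrow> H (addrow_mat n s k l)"
    and g: "g \<in> carrier_mat n n" "det g = 1"
  shows "H g"
proof -
  have row: "H A" if "H (addrow s k l A)" "A \<in> carrier_mat n n" "det A = 1" "k < n" "l < n" "k \<noteq> l" for s k l A
  proof -
    have "addrow (- s) k l (addrow s k l A) = A"
      by (rule eq_matI) (use that in auto)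
    then have "A = addrow_mat n (- s) k l * addrow s k l A"
      using addrow_mat[of "addrow s k l A" n n l "- s" k] that by simp
    moreover have "H (addrow_mat n (- s) k l * addrow s k l A)"
      by (rule mult) (use that elem in \<open>auto simp: det_addrow_mat det_addrow\<close>)
    ultimately show ?thesis by simp
  qed
  have det_addcol: "det (addcol s l k A) = 1"
    if "A \<in> carrier_mat n n" "det A = 1" "k < n" "k \<noteq> l" for s k l A
    using addcol_mat[OF that(1,3), of s l] det_mult[of A n "addrow_mat n s k l"] that
    by (simp add: det_addrow_mat)
  have col: "H A" if "H (addcol s l k A)" "A \<in> carrier_mat n n" "det A = 1" "k < n" "l < n" "k \<noteq> l" for s k l A
  proof -
    have c: "addcol s l k A \<in> carrier_mat n n" using that by (intro carrier_matI) auto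
    have "addcol (- s) l k (addcol s l k A) = A"
      by (rule eq_matI) (use that in auto)
    then have A: "A = addcol s l k A * addrow_mat n (- s) k l"
      using addcol_mat[OF c that(4), of "- s" l] by simp
    have "H (addcol s l k A * addrow_mat n (- s) k l)"
      by (rule mult) (use c that elem det_addcol in \<open>auto simp: det_addrow_mat\<close>)
    with A show ?thesis by simp
  qed
  define P where "P = (\<lambda>m (A :: 'a mat). A \<in> carrier_mat n n \<and> det A = 1 \<and>
    (\<forall>i<n. \<forall>j<n. i < m \<or> j < m \<longrightarrow> A $$ (i, j) = (if i = j then 1 else 0)))"
  have P_row: "P m (addrow s k l A)" if "P m A" "m \<le> k" "m \<le> l" "k < n" "l < n" "k \<noteq> l" for m s k l A
    using that by (auto simp: P_def det_addrow)
  have P_col: "P m (addcol s l k A)" if "P m A" "m \<le> k" "m \<le> l" "k < n" "l < n" "k \<noteq> l" for m s k l A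
    using that det_addcol[of A k l s] by (auto simp: P_def intro!: carrier_matI)
  have "H A" if "m \<le> n" "P m A" for m A
    using that
  proof (induction m arbitrary: A rule: inc_induct)
    case base
    then have "A = 1\<^sub>m n" by (intro eq_matI) (auto simp: P_def)
    then show ?case using one by simp
  next
    case (step m)
    have clear_row: "H B"
      if "Suc m \<le> t" "t \<le> n" "P m B" "B $$ (m, m) = 1" "\<And>i. m < i \<Longrightarrow> i < n \<Longrightarrow> B $$ (i, m) = 0"
        "\<And>j. t \<le> j \<Longrightarrow> j < n \<Longrightarrow> B $$ (m, j) = 0" for t B
      using that
    proof (induction t arbitrary: B rule: dec_induct)
      case base
      have "B $$ (i, m) = 0 \<and> B $$ (m, i) = 0" if "i \<noteq> m" "i < n" for i
        using base that step.hyps by (cases "i < m") (auto simp: P_def)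
      then have "P (Suc m) B"
        using base by (auto simp: P_def less_Suc_eq)
      then show ?case by (rule step.IH)
    next
      case (step t)
      have B: "B \<in> carrier_mat n n" "det B = 1" using step.prems(2) by (auto simp: P_def)
      have "H (addcol (- B $$ (m, t)) t m B)"
        by (rule step.IH) (use B step.hyps step.prems P_col in auto)
      then show ?case by (rule col) (use B step.hyps step.prems in auto)
    qed
    have clear_col: "H B"
      if "Suc m \<le> t" "t \<le> n" "P m B" "B $$ (m, m) = 1" "\<And>i. t \<le> i \<Longrightarrow> i < n \<Longrightarrow> B $$ (i, m) = 0" for t B
      using that
    proof (induction t arbitrary: B rule: dec_induct)
      case base
      show ?case by (rule clear_row[of n]) (use base step.hyps in auto)
    next
      case (step t)
      have B: "B \<in> carrier_mat n n" "det B = 1" using step.prems(2) by (auto simp: P_def)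
      have "H (addrow (- B $$ (t, m)) t m B)"
        by (rule step.IH) (use B step.hyps step.prems P_row in auto)
      then show ?case by (rule row) (use B step.hyps step.prems in auto)
    qed
    have unit: "H B" if "P m B" "B $$ (m, m) = 1" for B
      by (rule clear_col[of n]) (use that step.hyps in auto)
    have below: "H B" if "P m B" "m < i" "i < n" "B $$ (i, m) \<noteq> 0" for B i
    proof -
      have B: "B \<in> carrier_mat n n" "det B = 1" using that(1) by (auto simp: P_def)
      have "H (addrow ((1 - B $$ (m, m)) / B $$ (i, m)) m i B)"
        by (rule unit) (use B that P_row step.hyps in auto)
      then show ?thesis by (rule row) (use B that in auto)
    qed
    have A: "A \<in> carrier_mat n n" "det A = 1" using step.prems by (auto simp: P_def)
    consider i where "m < i" "i < n" "A $$ (i, m) \<noteq> 0" |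
      "\<And>i. m < i \<Longrightarrow> i < n \<Longrightarrow> A $$ (i, m) = 0" "A $$ (m, m) = 0" |
      "A $$ (m, m) \<noteq> 0" "Suc m < n" | "Suc m = n"
      using step.hyps by fastforce
    then show ?case
    proof cases
      case 1
      then show ?thesis using below step.prems by blast
    next
      case 2
      have zero: "A $$ (i, m) = 0" if "i < n" for i
        using 2 step.prems step.hyps that by (cases i m rule: linorder_cases) (auto simp: P_def)
      \<comment> \<open>A vanishing column is not changed by scaling it with 0, which makes the determinant 0.\<close>
      have "multcol m 0 A = A" by (rule eq_matI) (use A zero step.hyps in auto)
      then have "det A = det A * det (multrow_mat n m 0)"
        using multcol_mat[OF A(1), of m 0] det_mult[of A n "multrow_mat n m 0"] A by simp
      then show ?thesis using A step.hyps by (simp add: det_multrow_mat)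
    next
      case 3
      \<comment> \<open>If the new entry below \<open>(m, m)\<close> happens to vanish, then the old one does not.\<close>
      have "H (addrow 1 (Suc m) m A)"
      proof (cases "A $$ (m, m) + A $$ (Suc m, m) = 0")
        case True
        then have "A $$ (Suc m, m) \<noteq> 0" using 3 by auto
        then have "H A" using below[of A "Suc m"] step.prems 3 by auto
        then have "H (addrow_mat n 1 (Suc m) m * A)"
          using A 3 elem by (intro mult) (auto simp: det_addrow_mat)
        then show ?thesis using addrow_mat[OF A(1), of m 1 "Suc m"] 3 by simp
      next
        case False
        then show ?thesis
          by (intro below[of _ "Suc m"]) (use A 3 step.prems P_row in auto)
      qed
      then show ?thesis by (rule row) (use A 3 in auto)
    next
      case 4
      have "A $$ (i, j) = 0" if "i < j" "j < n" for i j
        using step.prems 4 that by (auto simp: P_def)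
      then have "det A = prod_list (diag_mat A)" using A(1) by (rule det_lower_triangular)
      also have "\<dots> = (\<Prod>i=0..<n. A $$ (i, i))" using A(1) by (simp add: prod_list_diag_prod)
      also have "\<dots> = A $$ (m, m) * (\<Prod>i\<in>{0..<n} - {m}. A $$ (i, i))"
        using step.hyps by (subst prod.remove[of _ m]) auto
      also have "(\<Prod>i\<in>{0..<n} - {m}. A $$ (i, i)) = 1"
        by (rule prod.neutral) (use step.prems 4 in \<open>auto simp: P_def\<close>)
      finally show ?thesis using A step.prems by (intro unit) auto
    qed
  qed
  moreover have "P 0 g" using g by (simp add: P_def)
  ultimately show ?thesis by blast
qed

text \<open>
  The matrices \<open>1 + s E\<^bsub>k,l\<^esub>\<close> with \<open>\<bar>k - l\<bar> > 1\<close> are commutators of those with smaller \<open>\<bar>k - l\<bar>\<close>.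
\<close>

lemma SL_induct_simple:
  fixes H :: "'a :: field mat \<Rightarrow> bool"
  assumes one: "H (1\<^sub>m n)"
    and mult: "\<And>A B. A \<in> carrier_mat n n \<Longrightarrow> B \<in> carrier_mat n n \<Longrightarrow> det A = 1 \<Longrightarrow> det B = 1 \<Longrightarrow>
      H A \<Longrightarrow> H B \<Longrightarrow> H (A * B)"
    and up: "\<And>s k. Suc k < n \<Longrightarrow> H (addrow_mat n s k (Suc k))"
    and down: "\<And>s k. Suc k < n \<Longrightarrow> H (addrow_mat n s (Suc k) k)"
    and g: "g \<in> carrier_mat n n" "det g = 1"
  shows "H g"
proof (rule SL_induct_elementary[of H n])
  have comm: "H (addrow_mat n s k m)"
    if "\<And>s. H (addrow_mat n s k l)" "\<And>s. H (addrow_mat n s l m)"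
      "k < n" "l < n" "m < n" "k \<noteq> l" "l \<noteq> m" "k \<noteq> m" for s k l m
  proof -
    have "H (addrow_mat n s k l * (addrow_mat n 1 l m * (addrow_mat n (- s) k l * addrow_mat n (- 1) l m)))"
      using that
      by (intro mult) (auto simp: det_addrow_mat det_mult[OF addrow_mat_carrier addrow_mat_carrier]
        det_mult[OF addrow_mat_carrier mult_carrier_mat[OF addrow_mat_carrier addrow_mat_carrier]])
    then show ?thesis unfolding addrow_mat_commutator[OF that(3-)] by simp
  qed
  have upper: "H (addrow_mat n s k (k + d + 1))" if "k + d + 1 < n" for s k d
    using that
  proof (induction d arbitrary: s)
    case (Suc d)
    show ?case
      by (rule comm[of k "k + d + 1"]) (use Suc up[of "k + d + 1"] in auto)
  qed (use up in simp)
  have lower: "H (addrow_mat n s (k + d + 1) k)" if "k + d + 1 < n" for s k d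
    using that
  proof (induction d arbitrary: s)
    case (Suc d)
    show ?case
      by (rule comm[of _ "k + d + 1"]) (use Suc down[of "k + d + 1"] in auto)
  qed (use down in simp)
  show "H (addrow_mat n s k l)" if "k < n" "l < n" "k \<noteq> l" for s k l
  proof (cases "k < l")
    case True
    then show ?thesis using upper[of k "l - k - 1" s] that by simp
  next
    case False
    then show ?thesis using lower[of l "k - l - 1" s] that by simp
  qed
qed (use assms in auto)

section \<open>One-parameter subgroups and tori in a representation\<close>

lemma index_mult_mat_vec_sum:
  assumes "A \<in> carrier_mat m k" "v \<in> carrier_vec k" "i < m"
  shows "(A *\<^sub>v v) $ i = (\<Sum>j<k. A $$ (i, j) * v $ j)"
  using assms by (simp add: scalar_prod_def lessThan_atLeast0)

lemma polynomial_function_differentiable: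
  assumes "p \<in> polynomial_functions n"
  shows "(\<lambda>s. p (addrow_mat n s k l)) field_differentiable (at z)"
  using assms
proof induction
  case (entry i j)
  have "(\<lambda>s :: complex. addrow_mat n s k l $$ (i, j)) =
      (\<lambda>s. (if k = i \<and> l = j then s else 0) + (if i = j then 1 else 0))"
    using entry by (auto simp: fun_eq_iff)
  moreover have "(\<lambda>s :: complex. (if k = i \<and> l = j then s else 0) + c) field_differentiable (at z)" for c
    by (cases "k = i \<and> l = j") (auto intro!: field_differentiable_add)
  ultimately show ?case by simp
qed (auto intro: field_differentiable_add field_differentiable_mult)

lemma mem_SL: "g \<in> carrier (SL n) \<longleftrightarrow> g \<in> carrier_mat n n \<and> det g = 1"
  by (simp add: SL_def)

lemma addrow_mat_in_SL: "k \<noteq> l \<Longrightarrow> addrow_mat n s k l \<in> carrier (SL n)"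
  by (simp add: mem_SL det_addrow_mat)

lemma addrow_mat_zero: "addrow_mat n 0 k l = 1\<^sub>m n"
  by (rule eq_matI) auto

lemma addrow_mat_add:
  fixes a b :: "'a :: comm_ring_1"
  assumes "k < n" "l < n" "k \<noteq> l"
  shows "addrow_mat n a k l * addrow_mat n b k l = addrow_mat n (a + b) k l"
proof -
  have "addrow_mat n a k l * addrow_mat n b k l = addrow a k l (addrow_mat n b k l)"
    by (rule addrow_mat[symmetric]) (use assms in auto)
  also have "\<dots> = addrow_mat n (a + b) k l"
    by (rule eq_matI) (use assms in auto)
  finally show ?thesis .
qed

lemma monoid_SL: "monoid (SL n)"
  by (rule monoidI) (auto simp: SL_def det_mult[of _ n] assoc_mult_mat[of _ n n _ n _ n])

lemma SL_inverse:
  assumes "g \<in> carrier (SL n)" "h \<in> carrier (SL n)" "g * h = 1\<^sub>m n" "h * g = 1\<^sub>m n"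
  shows "inv\<^bsub>SL n\<^esub> g = h"
  using monoid.inv_unique'[OF monoid_SL assms(1,2)] assms(3,4) by (simp add: SL_def)

text \<open>
  The value at \<open>z\<close> of the coroot \<open>\<alpha>\<^sub>i\<^sup>\<or>\<close>, a cocharacter of the diagonal torus.  Counted from 1, the
  positions of \<open>z\<close> and \<open>1/z\<close> are \<open>i\<close> and \<open>i + 1\<close>.
\<close>

definition coroot :: "nat \<Rightarrow> nat \<Rightarrow> complex \<Rightarrow> complex mat" where
  "coroot n i z = mat n n (\<lambda>(p, q). if p \<noteq> q then 0 else if p + 1 = i then z else if p = i then 1 / z else 1)"

lemma coroot_diagonal: "diagonal_mat (coroot n i z)"
  by (auto simp: diagonal_mat_def coroot_def)

lemma coroot_in_SL:
  assumes "1 \<le> i" "i < n" "z \<noteq> 0"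
  shows "coroot n i z \<in> carrier (SL n)"
proof -
  have "det (coroot n i z) = prod_list (diag_mat (coroot n i z))"
    by (rule det_upper_triangular[of _ n]) (auto simp: coroot_def)
  also have "\<dots> = (\<Prod>p=0..<n. if p + 1 = i then z else if p = i then 1 / z else 1)"
    unfolding prod_list_diag_prod by (rule prod.cong) (auto simp: coroot_def)
  also have "\<dots> = (\<Prod>p\<in>{i - 1, i}. if p + 1 = i then z else if p = i then 1 / z else 1)"
    by (rule prod.mono_neutral_right) (use assms in auto)
  also have "\<dots> = 1" using assms by simp
  finally show ?thesis by (simp add: mem_SL coroot_def)
qed

lemma coroot_inverse:
  assumes "1 \<le> i" "i < n" "z \<noteq> 0"
  shows "inv\<^bsub>SL n\<^esub> (coroot n i z) = coroot n i (1 / z)"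
proof -
  have "coroot n i z * coroot n i (1 / z) = 1\<^sub>m n" if "z \<noteq> 0" for z
  proof (rule eq_matI)
    fix p q assume pq: "p < dim_row (1\<^sub>m n :: complex mat)" "q < dim_col (1\<^sub>m n :: complex mat)"
    have "(coroot n i z * coroot n i (1 / z)) $$ (p, q) =
        (\<Sum>r<n. coroot n i z $$ (p, r) * coroot n i (1 / z) $$ (r, q))"
      using pq by (simp add: coroot_def scalar_prod_def lessThan_atLeast0)
    also have "\<dots> = (\<Sum>r<n. if r = p then coroot n i z $$ (p, p) * coroot n i (1 / z) $$ (p, q) else 0)"
      by (rule sum.cong) (use pq in \<open>auto simp: coroot_def\<close>)
    also have "\<dots> = 1\<^sub>m n $$ (p, q)"
      using pq that by (auto simp: coroot_def)
    finally show "(coroot n i z * coroot n i (1 / z)) $$ (p, q) = 1\<^sub>m n $$ (p, q)" .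
  qed (auto simp: coroot_def)
  from this[of z] this[of "1 / z"] show ?thesis
    using assms by (intro SL_inverse) (auto simp: coroot_in_SL)
qed

lemma weight_character_coroot:
  assumes "1 \<le> i" "i < n" "z \<noteq> 0"
  shows "weight_character n \<mu> (coroot n i z) = z powi \<mu> i"
proof -
  have *: "(\<Prod>j=1..m. coroot n i z $$ (j - 1, j - 1)) = (if m = i then z else 1)" if "m \<in> {1..n-1}" for m
  proof -
    have "(\<Prod>j=1..m. coroot n i z $$ (j - 1, j - 1)) = (\<Prod>j=1..m. if j = i then z else if j = i + 1 then 1 / z else 1)"
      by (rule prod.cong) (use that in \<open>auto simp: coroot_def\<close>)
    also have "\<dots> = (\<Prod>j\<in>{1..m} \<inter> {i, i + 1}. if j = i then z else if j = i + 1 then 1 / z else 1)"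
      by (rule prod.mono_neutral_right) auto
    also have "{1..m} \<inter> {i, i + 1} = (if m < i then {} else if m = i then {i} else {i, i + 1})"
      using assms by auto
    finally show ?thesis using assms by auto
  qed
  have "weight_character n \<mu> (coroot n i z) = (\<Prod>m=1..n-1. if m = i then z powi \<mu> i else 1)"
    unfolding weight_character_def by (rule prod.cong) (use * in auto)
  also have "\<dots> = z powi \<mu> i" using assms by simp
  finally show ?thesis .
qed

lemma coroot_conjugates_addrow_mat:
  assumes "1 \<le> i" "i < n" "1 \<le> k" "k < n"
  shows "coroot n i 2 * addrow_mat n s (k - 1) k =
    addrow_mat n (2 powi simple_root k i * s) (k - 1) k * coroot n i 2"
proof (rule eq_matI)
  fix p q assume "p < dim_row (addrow_mat n (2 powi simple_root k i * s) (k - 1) k * coroot n i 2)"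
    "q < dim_col (addrow_mat n (2 powi simple_root k i * s) (k - 1) k * coroot n i 2)"
  then have pq: "p < n" "q < n" by (auto simp: coroot_def)
  have "(coroot n i 2 * addrow_mat n s (k - 1) k) $$ (p, q) =
      (\<Sum>r<n. coroot n i 2 $$ (p, r) * addrow_mat n s (k - 1) k $$ (r, q))"
    using pq by (simp add: coroot_def scalar_prod_def lessThan_atLeast0)
  also have "\<dots> = (\<Sum>r<n. if r = p then coroot n i 2 $$ (p, p) * addrow_mat n s (k - 1) k $$ (p, q) else 0)"
    by (rule sum.cong) (use pq in \<open>auto simp: coroot_def\<close>)
  also have "\<dots> = coroot n i 2 $$ (p, p) * addrow_mat n s (k - 1) k $$ (p, q)"
    using pq by simp
  also have "\<dots> = addrow_mat n (2 powi simple_root k i * s) (k - 1) k $$ (p, q) * coroot n i 2 $$ (q, q)"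
  proof (cases "p = k - 1 \<and> q = k")
    case True
    consider "i = k" | "k = i + 1" | "i = k + 1" | "i \<noteq> k" "k \<noteq> i + 1" "i \<noteq> k + 1"
      by blast
    then have "coroot n i 2 $$ (k - 1, k - 1) = 2 powi simple_root k i * coroot n i 2 $$ (k, k)"
      using assms by cases (auto simp: coroot_def simple_root_def)
    moreover have "k - 1 \<noteq> k" using assms by simp
    ultimately show ?thesis using True assms by simp
  next
    case False
    then have "addrow_mat n x (k - 1) k $$ (p, q) = (if p = q then 1 else 0)" for x :: complex
      using pq by auto
    then show ?thesis by simp
  qed
  also have "\<dots> = (\<Sum>r<n. if r = q then addrow_mat n (2 powi simple_root k i * s) (k - 1) k $$ (p, q) * coroot n i 2 $$ (q, q) else 0)"
    using pq by simp
  also have "\<dots> = (\<Sum>r<n. addrow_mat n (2 powi simple_root k i * s) (k - 1) k $$ (p, r) * coroot n i 2 $$ (r, q))"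
    by (rule sum.cong) (use pq in \<open>auto simp: coroot_def\<close>)
  also have "\<dots> = (addrow_mat n (2 powi simple_root k i * s) (k - 1) k * coroot n i 2) $$ (p, q)"
    using pq by (simp add: coroot_def scalar_prod_def lessThan_atLeast0)
  finally show "(coroot n i 2 * addrow_mat n s (k - 1) k) $$ (p, q) =
      (addrow_mat n (2 powi simple_root k i * s) (k - 1) k * coroot n i 2) $$ (p, q)" .
qed (auto simp: coroot_def)

locale rational_rep =
  fixes n N :: nat and \<rho> :: "complex mat \<Rightarrow> complex mat"
  assumes rational: "rational_representation n N \<rho>"
begin

lemma GL_image: "g \<in> carrier (SL n) \<Longrightarrow> \<rho> g \<in> Units (ring_mat TYPE(complex) N ())"
  using rational by (auto simp: rational_representation_def hom_def GL_def units_of_def)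

lemma rho_carrier [simp]: "g \<in> carrier (SL n) \<Longrightarrow> \<rho> g \<in> carrier_mat N N"
  using GL_image[of g] by (auto simp: Units_def ring_mat_def)

lemma rho_mult: "g \<in> carrier (SL n) \<Longrightarrow> h \<in> carrier (SL n) \<Longrightarrow> \<rho> (g * h) = \<rho> g * \<rho> h"
  using rational by (auto simp: rational_representation_def hom_def GL_def units_of_def SL_def ring_mat_def)

lemma rho_one: "\<rho> (1\<^sub>m n) = 1\<^sub>m N"
proof -
  have 1: "1\<^sub>m n \<in> carrier (SL n)" by (simp add: mem_SL)
  obtain B where B: "B \<in> carrier_mat N N" "B * \<rho> (1\<^sub>m n) = 1\<^sub>m N"
    using GL_image[OF 1] by (auto simp: Units_def ring_mat_def)
  have "\<rho> (1\<^sub>m n) * \<rho> (1\<^sub>m n) = \<rho> (1\<^sub>m n)" using rho_mult[OF 1 1] by simp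
  then have "B * (\<rho> (1\<^sub>m n) * \<rho> (1\<^sub>m n)) = 1\<^sub>m N" using B by simp
  then show ?thesis
    using B rho_carrier[OF 1] by (metis assoc_mult_mat left_mult_one_mat)
qed

lemma rho_mult_vec:
  assumes "g \<in> carrier (SL n)" "h \<in> carrier (SL n)" "v \<in> carrier_vec N"
  shows "\<rho> (g * h) *\<^sub>v v = \<rho> g *\<^sub>v (\<rho> h *\<^sub>v v)"
  using assms by (simp add: rho_mult assoc_mult_mat_vec[of _ N N _ N])

lemma action_carrier [simp]: "root_vector_action n N \<rho> k l \<in> carrier_mat N N"
  by (simp add: root_vector_action_def)

lemma action_DERIV_zero:
  assumes "1 \<le> k" "k \<le> n" "1 \<le> l" "l \<le> n" "k \<noteq> l" "i < N" "j < N"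
  shows "((\<lambda>s. \<rho> (addrow_mat n s (k - 1) (l - 1)) $$ (i, j)) has_field_derivative
    root_vector_action n N \<rho> k l $$ (i, j)) (at 0)"
proof -
  have kl: "k - 1 \<noteq> l - 1" using assms by auto
  have x: "1\<^sub>m n + s \<cdot>\<^sub>m matrix_unit n k l = addrow_mat n s (k - 1) (l - 1)" for s :: complex
    by (rule eq_matI) (use assms kl in \<open>auto simp: matrix_unit_def\<close>)
  obtain p where p: "p \<in> polynomial_functions n" "\<forall>g\<in>carrier (SL n). \<rho> g $$ (i, j) = p g"
    using rational assms(6,7) unfolding rational_representation_def by blast
  have eq: "(\<lambda>s. \<rho> (addrow_mat n s (k - 1) (l - 1)) $$ (i, j)) = (\<lambda>s. p (addrow_mat n s (k - 1) (l - 1)))"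
    using p(2) addrow_mat_in_SL[OF kl] by auto
  have "root_vector_action n N \<rho> k l $$ (i, j) = deriv (\<lambda>s. p (addrow_mat n s (k - 1) (l - 1))) 0"
    unfolding eq[symmetric] using assms by (simp add: root_vector_action_def x)
  then show ?thesis
    unfolding eq using polynomial_function_differentiable[OF p(1)]
    by (simp only: DERIV_deriv_iff_field_differentiable)
qed

text \<open>The derivative at \<open>z\<close> reduces to the one at 0 because \<open>s \<mapsto> 1 + s E\<^bsub>k,l\<^esub>\<close> is a homomorphism.\<close>

lemma action_DERIV:
  assumes kl: "1 \<le> k" "k \<le> n" "1 \<le> l" "l \<le> n" "k \<noteq> l" and "i < N" and v: "v \<in> carrier_vec N"
  shows "((\<lambda>s. (\<rho> (addrow_mat n s (k - 1) (l - 1)) *\<^sub>v v) $ i) has_field_derivative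
    (\<rho> (addrow_mat n z (k - 1) (l - 1)) *\<^sub>v (root_vector_action n N \<rho> k l *\<^sub>v v)) $ i) (at z)"
proof -
  let ?x = "\<lambda>s. addrow_mat n s (k - 1) (l - 1)" and ?X = "root_vector_action n N \<rho> k l"
  have ne: "k - 1 \<noteq> l - 1" using kl by auto
  have x: "\<rho> (?x s) \<in> carrier_mat N N" for s by (rule rho_carrier[OF addrow_mat_in_SL[OF ne]])
  have eq: "(\<rho> (?x s) *\<^sub>v v) $ i = (\<Sum>j<N. \<rho> (?x z) $$ (i, j) * (\<Sum>m<N. \<rho> (?x (s - z)) $$ (j, m) * v $ m))" for s
  proof -
    have "?x s = ?x z * ?x (s - z)" using kl ne by (subst addrow_mat_add) auto
    then have "\<rho> (?x s) *\<^sub>v v = \<rho> (?x z) *\<^sub>v (\<rho> (?x (s - z)) *\<^sub>v v)"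
      using rho_mult_vec[OF addrow_mat_in_SL[OF ne] addrow_mat_in_SL[OF ne] v, of z "s - z"] by (simp only:)
    then have "(\<rho> (?x s) *\<^sub>v v) $ i = (\<rho> (?x z) *\<^sub>v (\<rho> (?x (s - z)) *\<^sub>v v)) $ i"
      by (rule arg_cong)
    also have "\<dots> = (\<Sum>j<N. \<rho> (?x z) $$ (i, j) * (\<rho> (?x (s - z)) *\<^sub>v v) $ j)"
      by (rule index_mult_mat_vec_sum[OF x mult_mat_vec_carrier[OF x v] assms(6)])
    also have "\<dots> = (\<Sum>j<N. \<rho> (?x z) $$ (i, j) * (\<Sum>m<N. \<rho> (?x (s - z)) $$ (j, m) * v $ m))"
      by (rule sum.cong[OF refl]) (simp only: index_mult_mat_vec_sum[OF x v] lessThan_iff)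
    finally show ?thesis .
  qed
  have D: "((\<lambda>s. \<rho> (?x (s - z)) $$ (j, m)) has_field_derivative ?X $$ (j, m)) (at z)" if "j < N" "m < N" for j m
    using DERIV_shift[of "\<lambda>s. \<rho> (?x s) $$ (j, m)" "?X $$ (j, m)" z "- z"] action_DERIV_zero[OF kl that]
    by simp
  have "((\<lambda>s. \<Sum>j<N. \<rho> (?x z) $$ (i, j) * (\<Sum>m<N. \<rho> (?x (s - z)) $$ (j, m) * v $ m)) has_field_derivative
      (\<Sum>j<N. \<rho> (?x z) $$ (i, j) * (\<Sum>m<N. ?X $$ (j, m) * v $ m))) (at z)"
    by (intro DERIV_sum DERIV_cmult DERIV_cmult_right D) auto
  also have "(\<Sum>j<N. \<rho> (?x z) $$ (i, j) * (\<Sum>m<N. ?X $$ (j, m) * v $ m)) =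
      (\<Sum>j<N. \<rho> (?x z) $$ (i, j) * (?X *\<^sub>v v) $ j)"
    by (rule sum.cong[OF refl]) (simp only: index_mult_mat_vec_sum[OF action_carrier v] lessThan_iff)
  also have "\<dots> = (\<rho> (?x z) *\<^sub>v (?X *\<^sub>v v)) $ i"
    by (rule index_mult_mat_vec_sum[OF x mult_mat_vec_carrier[OF action_carrier v] assms(6), symmetric])
  finally show ?thesis unfolding eq .
qed

lemma action_DERIV_at_zero:
  assumes kl: "1 \<le> k" "k \<le> n" "1 \<le> l" "l \<le> n" "k \<noteq> l" and "i < N" and v: "v \<in> carrier_vec N"
  shows "((\<lambda>s. (\<rho> (addrow_mat n s (k - 1) (l - 1)) *\<^sub>v v) $ i) has_field_derivative
    (root_vector_action n N \<rho> k l *\<^sub>v v) $ i) (at 0)"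
  using action_DERIV[OF assms, of 0] mult_mat_vec_carrier[OF action_carrier[of k l] v]
  by (simp add: addrow_mat_zero rho_one del: index_mult_mat_vec)

lemma action_eq_zero_if_fixed:
  assumes kl: "1 \<le> k" "k \<le> n" "1 \<le> l" "l \<le> n" "k \<noteq> l" and v: "v \<in> carrier_vec N"
    and fixed: "\<And>s. \<rho> (addrow_mat n s (k - 1) (l - 1)) *\<^sub>v v = v"
  shows "root_vector_action n N \<rho> k l *\<^sub>v v = 0\<^sub>v N"
proof (rule eq_vecI)
  fix i assume "i < dim_vec (0\<^sub>v N :: complex vec)"
  then have i: "i < N" by simp
  have "((\<lambda>s. v $ i) has_field_derivative (root_vector_action n N \<rho> k l *\<^sub>v v) $ i) (at 0)"
    using action_DERIV_at_zero[OF kl i v] by (simp only: fixed)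
  then have "(root_vector_action n N \<rho> k l *\<^sub>v v) $ i = 0"
    using DERIV_unique DERIV_const by blast
  then show "(root_vector_action n N \<rho> k l *\<^sub>v v) $ i = 0\<^sub>v N $ i" using i by simp
qed (simp add: root_vector_action_def)

text \<open>The analogue for the dual representation, whose vectors are functionals by means of the dot product.\<close>

lemma functional_annihilates_action:
  assumes kl: "1 \<le> k" "k \<le> n" "1 \<le> l" "l \<le> n" "k \<noteq> l"
    and v: "v \<in> carrier_vec N" and w: "w \<in> carrier_vec N"
    and fixed: "\<And>s. dual_rep n \<rho> (addrow_mat n s (k - 1) (l - 1)) *\<^sub>v v = v"
  shows "v \<bullet> (root_vector_action n N \<rho> k l *\<^sub>v w) = 0"
proof -
  let ?x = "\<lambda>s. addrow_mat n s (k - 1) (l - 1)" and ?X = "root_vector_action n N \<rho> k l"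
  have ne: "k - 1 \<noteq> l - 1" using kl by auto
  have x: "\<rho> (?x s) \<in> carrier_mat N N" for s by (rule rho_carrier[OF addrow_mat_in_SL[OF ne]])
  have inv: "inv\<^bsub>SL n\<^esub> (?x s) = ?x (- s)" for s
    using kl ne by (intro SL_inverse addrow_mat_in_SL) (auto simp: addrow_mat_add addrow_mat_zero)
  have const: "v \<bullet> (\<rho> (?x s) *\<^sub>v w) = v \<bullet> w" for s
  proof -
    have "v \<bullet> (\<rho> (?x s) *\<^sub>v w) = (transpose_mat (\<rho> (?x s)) *\<^sub>v v) \<bullet> w"
      using transpose_vec_mult_scalar[OF x w v] by simp
    also have "transpose_mat (\<rho> (?x s)) *\<^sub>v v = v"
      using fixed[of "- s"] unfolding dual_rep_def inv by simp
    finally show ?thesis .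
  qed
  have sp: "v \<bullet> u = (\<Sum>i<N. v $ i * u $ i)" if "u \<in> carrier_vec N" for u
    using that by (simp add: scalar_prod_def lessThan_atLeast0)
  have "((\<lambda>s. \<Sum>i<N. v $ i * (\<rho> (?x s) *\<^sub>v w) $ i) has_field_derivative (\<Sum>i<N. v $ i * (?X *\<^sub>v w) $ i)) (at 0)"
    by (intro DERIV_sum DERIV_cmult action_DERIV_at_zero[OF kl _ w]) auto
  also have "(\<lambda>s. \<Sum>i<N. v $ i * (\<rho> (?x s) *\<^sub>v w) $ i) = (\<lambda>s. v \<bullet> w)"
    using const sp[OF mult_mat_vec_carrier[OF x w]] by simp
  also have "(\<Sum>i<N. v $ i * (?X *\<^sub>v w) $ i) = v \<bullet> (?X *\<^sub>v w)"
    using sp[OF mult_mat_vec_carrier[OF action_carrier w]] by simp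
  finally show ?thesis using DERIV_unique DERIV_const by blast
qed

text \<open>
  The derivative at 0 of \<open>t (1 + s E) = (1 + s r E) t\<close> for \<open>t = \<alpha>\<^sub>i\<^sup>\<or>(2)\<close>, where \<open>r\<close> is the value of the
  root \<open>\<alpha>\<^sub>k\<close> at \<open>t\<close>.
\<close>

lemma coroot_action:
  assumes i: "1 \<le> i" "i < n" and k: "1 \<le> k" "k < n" and v: "v \<in> carrier_vec N"
  shows "\<rho> (coroot n i 2) *\<^sub>v (root_vector_action n N \<rho> k (k + 1) *\<^sub>v v) =
    2 powi simple_root k i \<cdot>\<^sub>v (root_vector_action n N \<rho> k (k + 1) *\<^sub>v (\<rho> (coroot n i 2) *\<^sub>v v))"
    (is "?t *\<^sub>v (?X *\<^sub>v v) = ?r \<cdot>\<^sub>v (?X *\<^sub>v (?t *\<^sub>v v))")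
proof (rule eq_vecI)
  let ?x = "\<lambda>s. addrow_mat n s (k - 1) k"
  have ne: "k - 1 \<noteq> k" using k by auto
  have kl: "1 \<le> k" "k \<le> n" "1 \<le> k + 1" "k + 1 \<le> n" "k \<noteq> k + 1" using k by auto
  have x: "\<rho> (?x s) \<in> carrier_mat N N" for s by (rule rho_carrier[OF addrow_mat_in_SL[OF ne]])
  have tS: "coroot n i 2 \<in> carrier (SL n)" using i by (simp add: coroot_in_SL)
  then have t: "?t \<in> carrier_mat N N" by simp
  note D = action_DERIV_at_zero[OF kl, unfolded add_diff_cancel_right']
  fix p assume "p < dim_vec (?r \<cdot>\<^sub>v (?X *\<^sub>v (?t *\<^sub>v v)))"
  then have p: "p < N" by (simp add: root_vector_action_def)
  have eq: "(\<lambda>s. \<Sum>q<N. ?t $$ (p, q) * (\<rho> (?x s) *\<^sub>v v) $ q) = (\<lambda>s. (\<rho> (?x (?r * s)) *\<^sub>v (?t *\<^sub>v v)) $ p)"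
  proof
    fix s
    have "?t *\<^sub>v (\<rho> (?x s) *\<^sub>v v) = \<rho> (?x (?r * s)) *\<^sub>v (?t *\<^sub>v v)"
      by (simp only: rho_mult_vec[OF tS addrow_mat_in_SL[OF ne] v, symmetric]
        rho_mult_vec[OF addrow_mat_in_SL[OF ne] tS v, symmetric] coroot_conjugates_addrow_mat[OF i k])
    then show "(\<Sum>q<N. ?t $$ (p, q) * (\<rho> (?x s) *\<^sub>v v) $ q) = (\<rho> (?x (?r * s)) *\<^sub>v (?t *\<^sub>v v)) $ p"
      using index_mult_mat_vec_sum[OF t mult_mat_vec_carrier[OF x v] p, of s] by simp
  qed
  have 1: "((\<lambda>s. \<Sum>q<N. ?t $$ (p, q) * (\<rho> (?x s) *\<^sub>v v) $ q) has_field_derivative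
      (\<Sum>q<N. ?t $$ (p, q) * (?X *\<^sub>v v) $ q)) (at 0)"
    by (intro DERIV_sum DERIV_cmult D[OF _ v]) auto
  have 2: "((\<lambda>s. (\<rho> (?x (?r * s)) *\<^sub>v (?t *\<^sub>v v)) $ p) has_field_derivative
      (?X *\<^sub>v (?t *\<^sub>v v)) $ p * ?r) (at 0)"
    by (rule DERIV_chain'[where g = "\<lambda>s. (\<rho> (?x s) *\<^sub>v (?t *\<^sub>v v)) $ p"])
      (use D[OF p mult_mat_vec_carrier[OF t v]] in \<open>auto intro!: derivative_eq_intros\<close>)
  have "(\<Sum>q<N. ?t $$ (p, q) * (?X *\<^sub>v v) $ q) = (?X *\<^sub>v (?t *\<^sub>v v)) $ p * ?r"
    using DERIV_unique[OF 1] 2 unfolding eq by blast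
  then show "(?t *\<^sub>v (?X *\<^sub>v v)) $ p = (?r \<cdot>\<^sub>v (?X *\<^sub>v (?t *\<^sub>v v))) $ p"
    using p index_mult_mat_vec_sum[OF t mult_mat_vec_carrier[OF action_carrier v] p, of k "k + 1"]
    by (simp add: root_vector_action_def del: index_mult_mat_vec)
qed (use i in \<open>simp add: root_vector_action_def carrier_matD(1)[OF rho_carrier[OF coroot_in_SL]]\<close>)

end

section \<open>Gelfand--Tsetlin bases and their weights\<close>

lemma powi_two_inject:
  assumes "(2 :: complex) powi m = 2 powi k"
  shows "m = k"
proof -
  have "(2 :: real) powi m = 2 powi k"
    using arg_cong[OF assms, of norm] by (simp add: norm_power_int)
  then show ?thesis
    using power_int_strict_increasing[of m k "2 :: real"] power_int_strict_increasing[of k m "2 :: real"]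
    by (cases m k rule: linorder_cases) auto
qed

locale GT_rep = rational_rep n N \<rho> for n N :: nat and \<rho> :: "complex mat \<Rightarrow> complex mat" +
  fixes a :: "nat \<Rightarrow> nat" and e :: "pattern \<Rightarrow> complex vec"
  assumes GT_basis: "GT_basis n N \<rho> a e"
begin

lemma inj_e: "inj_on e (GT n a)"
  using GT_basis by (simp add: GT_basis_def)

lemma basis_e: "vectorspace.basis class_ring (module_vec TYPE(complex) N) (e ` GT n a)"
  using GT_basis by (simp add: GT_basis_def)

lemma e_carrier [simp]: "P \<in> GT n a \<Longrightarrow> e P \<in> carrier_vec N"
  using GT_basis by (auto simp: GT_basis_def weight_vector_def)

lemma finite_GT: "finite (GT n a)"
proof -
  interpret vec_space "TYPE(complex)" N .
  have "finite (e ` GT n a)"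
    using basis_e fin_dim_li_fin by (simp add: basis_def)
  then show ?thesis using inj_e by (rule finite_imageD)
qed

lemma e_independent:
  assumes zero: "\<And>r. r < N \<Longrightarrow> (\<Sum>P\<in>GT n a. c P * e P $ r) = 0" and P: "P \<in> GT n a"
  shows "c P = 0"
proof (rule ccontr)
  interpret vec_space "TYPE(complex)" N .
  assume ne: "c P \<noteq> 0"
  let ?c = "\<lambda>v. c (inv_into (GT n a) e v)"
  have sub: "e ` GT n a \<subseteq> carrier_vec N" by auto
  have "lincomb ?c (e ` GT n a) = 0\<^sub>v N"
  proof (rule eq_vecI)
    fix r assume "r < dim_vec (0\<^sub>v N :: complex vec)"
    then have r: "r < N" by simp
    have "lincomb ?c (e ` GT n a) $ r = (\<Sum>P\<in>GT n a. c P * e P $ r)"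
      unfolding lincomb_index[OF r sub] using inj_e by (simp add: sum.reindex)
    then show "lincomb ?c (e ` GT n a) $ r = 0\<^sub>v N $ r" using zero r by simp
  qed (use sub finite_GT in \<open>simp add: lincomb_dim\<close>)
  then have "lin_dep (e ` GT n a)"
    by (intro lin_dep_crit[where A = "e ` GT n a" and a = ?c and v = "e P"]) (use finite_GT inj_e P ne in auto)
  then show False using basis_e by (simp add: basis_def)
qed

lemma e_span:
  assumes "v \<in> carrier_vec N"
  obtains c where "\<And>r. r < N \<Longrightarrow> v $ r = (\<Sum>P\<in>GT n a. c P * e P $ r)"
proof -
  interpret vec_space "TYPE(complex)" N .
  have sub: "e ` GT n a \<subseteq> carrier_vec N" by auto
  have "v \<in> span (e ` GT n a)" using basis_e assms by (simp add: basis_def)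
  then obtain c where c: "lincomb c (e ` GT n a) = v"
    using finite_in_span[of "e ` GT n a" v] finite_GT sub by auto
  have "v $ r = (\<Sum>P\<in>GT n a. c (e P) * e P $ r)" if "r < N" for r
    unfolding c[symmetric] lincomb_index[OF that sub] using inj_e by (simp add: sum.reindex)
  then show ?thesis by (rule that)
qed

lemma e_subfamily_independent:
  assumes zero: "\<And>r. r < N \<Longrightarrow> (\<Sum>j\<in>J. d j * e (Q j) $ r) = 0"
    and "inj_on Q J" "Q ` J \<subseteq> GT n a" "j \<in> J"
  shows "d j = 0"
proof -
  define c where "c = (\<lambda>P. if P \<in> Q ` J then d (inv_into J Q P) else 0)"
  have "c (Q j) = 0"
  proof (rule e_independent)
    fix r assume r: "r < N"
    have "(\<Sum>P\<in>GT n a. c P * e P $ r) = (\<Sum>P\<in>Q ` J. c P * e P $ r)"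
      by (rule sum.mono_neutral_right) (use finite_GT assms(3) in \<open>auto simp: c_def\<close>)
    also have "\<dots> = (\<Sum>j\<in>J. d j * e (Q j) $ r)"
      using assms(2) by (simp add: sum.reindex c_def)
    finally show "(\<Sum>P\<in>GT n a. c P * e P $ r) = 0" using zero[OF r] by simp
  qed (use assms in auto)
  then show ?thesis using assms by (simp add: c_def)
qed

lemma mult_mat_vec_combination:
  fixes A :: "complex mat"
  assumes A: "A \<in> carrier_mat N N" and v: "v \<in> carrier_vec N" and r: "r < N"
    and comb: "\<And>r. r < N \<Longrightarrow> v $ r = (\<Sum>j\<in>J. c j * w j $ r)" and w: "\<And>j. j \<in> J \<Longrightarrow> w j \<in> carrier_vec N"
  shows "(A *\<^sub>v v) $ r = (\<Sum>j\<in>J. c j * (A *\<^sub>v w j) $ r)"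
proof -
  have "(A *\<^sub>v v) $ r = (\<Sum>q<N. \<Sum>j\<in>J. A $$ (r, q) * (c j * w j $ q))"
    unfolding index_mult_mat_vec_sum[OF A v r] by (rule sum.cong) (auto simp: comb sum_distrib_left)
  also have "\<dots> = (\<Sum>j\<in>J. \<Sum>q<N. A $$ (r, q) * (c j * w j $ q))" by (rule sum.swap)
  also have "\<dots> = (\<Sum>j\<in>J. c j * (A *\<^sub>v w j) $ r)"
    by (rule sum.cong[OF refl])
      (auto simp: index_mult_mat_vec_sum[OF A w r] sum_distrib_left simp del: index_mult_mat_vec intro!: sum.cong)
  finally show ?thesis .
qed

lemma finsum_e:
  fixes k :: nat
  assumes A: "A \<in> carrier_mat N N" and r: "r < N"
    and v: "v = finsum_vec TYPE(complex) N (\<lambda>i. c i \<cdot>\<^sub>v (if Q i \<in> GT n a then e (Q i) else 0\<^sub>v N)) {1..k}"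
  shows "(A *\<^sub>v v) $ r = (\<Sum>i=1..k. if Q i \<in> GT n a then c i * (A *\<^sub>v e (Q i)) $ r else 0)"
proof -
  let ?w = "\<lambda>i. if Q i \<in> GT n a then e (Q i) else 0\<^sub>v N"
  have w: "?w i \<in> carrier_vec N" for i by simp
  have vr: "v $ r = (\<Sum>i=1..k. c i * ?w i $ r)" if "r < N" for r
  proof -
    have "v $ r = (\<Sum>i=1..k. (c i \<cdot>\<^sub>v ?w i) $ r)"
      unfolding v by (rule index_finsum_vec) (use that w in auto)
    also have "\<dots> = (\<Sum>i=1..k. c i * ?w i $ r)"
      by (rule sum.cong[OF refl]) (use carrier_vecD[OF w] that in \<open>simp only: index_smult_vec\<close>)
    finally show ?thesis .
  qed
  have "v \<in> carrier_vec N" unfolding v by (rule finsum_vec_closed) (use w in auto)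
  then have "(A *\<^sub>v v) $ r = (\<Sum>i=1..k. c i * (A *\<^sub>v ?w i) $ r)"
    by (rule mult_mat_vec_combination[OF A _ r]) (use vr w in auto)
  also have "\<dots> = (\<Sum>i=1..k. if Q i \<in> GT n a then c i * (A *\<^sub>v e (Q i)) $ r else 0)"
    by (rule sum.cong[OF refl]) (use A r in auto)
  finally show ?thesis .
qed

lemma raising_action:
  assumes "P \<in> GT n a" "1 \<le> k" "k < n" "A \<in> carrier_mat N N" "r < N"
  shows "(A *\<^sub>v (root_vector_action n N \<rho> k (k + 1) *\<^sub>v e P)) $ r =
    (\<Sum>i=1..k. if add_entry P k i 1 \<in> GT n a then raising_coeff P k i * (A *\<^sub>v e (add_entry P k i 1)) $ r else 0)"
  by (rule finsum_e[OF assms(4,5)]) (use GT_basis assms in \<open>auto simp: GT_basis_def Let_def\<close>)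

lemma lowering_action:
  assumes "P \<in> GT n a" "1 \<le> k" "k < n" "A \<in> carrier_mat N N" "r < N"
  shows "(A *\<^sub>v (root_vector_action n N \<rho> (k + 1) k *\<^sub>v e P)) $ r =
    (\<Sum>i=1..k. if add_entry P k i (-1) \<in> GT n a then lowering_coeff P k i * (A *\<^sub>v e (add_entry P k i (-1))) $ r else 0)"
  by (rule finsum_e[OF assms(4,5)]) (use GT_basis assms in \<open>auto simp: GT_basis_def Let_def\<close>)

lemma raising_action_coords:
  assumes "P \<in> GT n a" "1 \<le> k" "k < n" "r < N"
  shows "(root_vector_action n N \<rho> k (k + 1) *\<^sub>v e P) $ r =
    (\<Sum>i=1..k. if add_entry P k i 1 \<in> GT n a then raising_coeff P k i * e (add_entry P k i 1) $ r else 0)"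
proof -
  have "(root_vector_action n N \<rho> k (k + 1) *\<^sub>v e P) $ r =
      (1\<^sub>m N *\<^sub>v (root_vector_action n N \<rho> k (k + 1) *\<^sub>v e P)) $ r"
    by (simp only: one_mult_mat_vec[OF mult_mat_vec_carrier[OF action_carrier e_carrier[OF assms(1)]]])
  also have "\<dots> = (\<Sum>i=1..k. if add_entry P k i 1 \<in> GT n a
      then raising_coeff P k i * (1\<^sub>m N *\<^sub>v e (add_entry P k i 1)) $ r else 0)"
    by (rule raising_action) (use assms in auto)
  also have "\<dots> = (\<Sum>i=1..k. if add_entry P k i 1 \<in> GT n a then raising_coeff P k i * e (add_entry P k i 1) $ r else 0)"
    by (rule sum.cong[OF refl], rule if_cong[OF refl _ refl]) (simp only: one_mult_mat_vec[OF e_carrier])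
  finally show ?thesis .
qed

text \<open>
  The weights are integral, so a weight is determined by its values at the elements \<open>\<alpha>\<^sub>i\<^sup>\<or>(2)\<close>.
\<close>

definition eigenvalue :: "nat \<Rightarrow> pattern \<Rightarrow> complex" where
  "eigenvalue i P = (SOME c. \<rho> (coroot n i 2) *\<^sub>v e P = c \<cdot>\<^sub>v e P)"

lemma eigenvalue:
  assumes "P \<in> GT n a" "1 \<le> i" "i < n"
  shows "\<rho> (coroot n i 2) *\<^sub>v e P = eigenvalue i P \<cdot>\<^sub>v e P"
proof -
  obtain \<mu> where "weight_vector n N \<rho> \<mu> (e P)"
    using GT_basis assms(1) by (auto simp: GT_basis_def)
  then have "\<rho> (coroot n i 2) *\<^sub>v e P = weight_character n \<mu> (coroot n i 2) \<cdot>\<^sub>v e P"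
    using assms coroot_in_SL[of i n 2] coroot_diagonal by (auto simp: weight_vector_def)
  then show ?thesis unfolding eigenvalue_def by (rule someI)
qed

lemma eigenvalue_index:
  assumes "P \<in> GT n a" "1 \<le> i" "i < n" "r < N"
  shows "(\<rho> (coroot n i 2) *\<^sub>v e P) $ r = eigenvalue i P * e P $ r"
  using eigenvalue[OF assms(1-3)] carrier_vecD[OF e_carrier[OF assms(1)]] assms(4) by simp

text \<open>
  The root vector \<open>X\<^sub>k\<close> shifts weights by \<open>\<alpha>\<^sub>k\<close>, and \<open>e\<^bsub>P+\<delta>\<^esub>\<close> occurs in \<open>X\<^sub>k e\<^sub>P\<close> with a nonzero coefficient.
\<close>

lemma eigenvalue_raise:
  assumes P: "P \<in> GT n a" and Q: "add_entry P k j 1 \<in> GT n a" and j: "1 \<le> j" "j \<le> k" "k < n"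
    and i: "1 \<le> i" "i < n"
  shows "eigenvalue i (add_entry P k j 1) = 2 powi simple_root k i * eigenvalue i P"
proof -
  let ?t = "\<rho> (coroot n i 2)" and ?X = "root_vector_action n N \<rho> k (k + 1)" and ?r = "2 powi simple_root k i :: complex"
  let ?J = "{m \<in> {1..k}. add_entry P k m 1 \<in> GT n a}"
  have k: "1 \<le> k" "k < n" using j by auto
  have t: "?t \<in> carrier_mat N N" using i by (simp add: coroot_in_SL)
  have XP: "?X *\<^sub>v e P \<in> carrier_vec N" using mult_mat_vec_carrier[OF action_carrier e_carrier[OF P]] .
  have "raising_coeff P k j * (eigenvalue i (add_entry P k j 1) - ?r * eigenvalue i P) = 0"
  proof (rule e_subfamily_independent[where Q = "\<lambda>m. add_entry P k m 1" and J = ?J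
        and d = "\<lambda>m. raising_coeff P k m * (eigenvalue i (add_entry P k m 1) - ?r * eigenvalue i P)"])
    fix r assume r: "r < N"
    have "?t *\<^sub>v (?X *\<^sub>v e P) = ?r \<cdot>\<^sub>v (?X *\<^sub>v (eigenvalue i P \<cdot>\<^sub>v e P))"
      using coroot_action[OF i k e_carrier[OF P]] eigenvalue[OF P i] by simp
    also have "?X *\<^sub>v (eigenvalue i P \<cdot>\<^sub>v e P) = eigenvalue i P \<cdot>\<^sub>v (?X *\<^sub>v e P)"
      by (rule mult_mat_vec[OF action_carrier e_carrier[OF P]])
    finally have "(?t *\<^sub>v (?X *\<^sub>v e P)) $ r = ?r * eigenvalue i P * (?X *\<^sub>v e P) $ r"
      using r carrier_vecD[OF XP] by (simp del: index_mult_mat_vec)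
    then have "(\<Sum>m=1..k. if add_entry P k m 1 \<in> GT n a then raising_coeff P k m * (?t *\<^sub>v e (add_entry P k m 1)) $ r else 0) =
        ?r * eigenvalue i P * (\<Sum>m=1..k. if add_entry P k m 1 \<in> GT n a then raising_coeff P k m * e (add_entry P k m 1) $ r else 0)"
      unfolding raising_action[OF P k t r] raising_action_coords[OF P k r] .
    then show "(\<Sum>m\<in>?J. raising_coeff P k m * (eigenvalue i (add_entry P k m 1) - ?r * eigenvalue i P) * e (add_entry P k m 1) $ r) = 0"
      by (simp add: sum.inter_filter[symmetric] eigenvalue_index[OF _ i r] sum_distrib_left sum_subtractf algebra_simps
        del: index_mult_mat_vec)
  next
    have "m = m'" if "add_entry P k m 1 = add_entry P k m' 1" for m m'
    proof (rule ccontr)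
      assume "m \<noteq> m'"
      then show False using fun_cong[OF fun_cong[OF that, of k], of m] by (simp add: add_entry_apply)
    qed
    then show "inj_on (\<lambda>m. add_entry P k m 1) ?J" by (auto simp: inj_on_def)
  qed (use j Q in auto)
  then show ?thesis using raising_coeff_nonzero[OF P Q j] by simp
qed

text \<open>
  A highest weight vector is killed by all raising operators, hence a multiple of the basis vector
  of the highest pattern.
\<close>

lemma eigenvalue_highest:
  assumes "has_highest_weight n N \<rho> a" and H: "H \<in> GT n a"
    and high: "\<And>k i. 1 \<le> i \<Longrightarrow> i \<le> k \<Longrightarrow> k < n \<Longrightarrow> H k i = H (Suc k) i"
    and i: "1 \<le> i" "i < n"
  shows "eigenvalue i H = 2 powi int (a i)"
proof -
  obtain v where v: "weight_vector n N \<rho> (\<lambda>i. int (a i)) v"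
    and fixed: "\<And>u. u \<in> carrier (SL n) \<Longrightarrow> upper_triangular u \<Longrightarrow> (\<forall>i<n. u $$ (i, i) = 1) \<Longrightarrow> \<rho> u *\<^sub>v v = v"
    using assms(1) by (auto simp: has_highest_weight_def)
  have vc: "v \<in> carrier_vec N" and v0: "v \<noteq> 0\<^sub>v N" using v by (auto simp: weight_vector_def)
  obtain \<phi> where \<phi>: "\<And>r. r < N \<Longrightarrow> v $ r = (\<Sum>P\<in>GT n a. \<phi> P * e P $ r)"
    using e_span[OF vc] by blast
  have kill: "(\<Sum>j=1..k. if add_entry R k j (-1) \<in> GT n a
      then raising_coeff (add_entry R k j (-1)) k j * \<phi> (add_entry R k j (-1)) else 0) = 0"
    if R: "R \<in> GT n a" and k: "1 \<le> k" "k < n" for R k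
  proof (rule e_independent[of "\<lambda>R. \<Sum>j=1..k. if add_entry R k j (-1) \<in> GT n a
      then raising_coeff (add_entry R k j (-1)) k j * \<phi> (add_entry R k j (-1)) else 0", OF _ R])
    fix r assume r: "r < N"
    let ?X = "root_vector_action n N \<rho> k (k + 1)"
    have ne: "k - 1 \<noteq> k" using k by simp
    have "?X *\<^sub>v v = 0\<^sub>v N"
    proof (rule action_eq_zero_if_fixed)
      show "\<rho> (addrow_mat n s (k - 1) (k + 1 - 1)) *\<^sub>v v = v" for s
        using k ne by (intro fixed addrow_mat_in_SL) (auto simp: upper_triangular_def)
    qed (use k vc in auto)
    then have "0 = (?X *\<^sub>v v) $ r" using r by simp
    also have "\<dots> = (\<Sum>P\<in>GT n a. \<phi> P * (?X *\<^sub>v e P) $ r)"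
      by (rule mult_mat_vec_combination) (use vc r \<phi> in auto)
    also have "\<dots> = (\<Sum>P\<in>GT n a. \<Sum>j=1..k. if add_entry P k j 1 \<in> GT n a
        then \<phi> P * raising_coeff P k j * e (add_entry P k j 1) $ r else 0)"
      by (rule sum.cong[OF refl], subst raising_action_coords)
        (use k r in \<open>auto simp: sum_distrib_left mult_ac intro!: sum.cong\<close>)
    also have "\<dots> = (\<Sum>j=1..k. \<Sum>P\<in>{P \<in> GT n a. add_entry P k j 1 \<in> GT n a}.
        \<phi> P * raising_coeff P k j * e (add_entry P k j 1) $ r)"
      by (subst sum.swap) (simp add: sum.inter_filter finite_GT)
    also have "\<dots> = (\<Sum>j=1..k. \<Sum>P\<in>{P \<in> GT n a. add_entry P k j (-1) \<in> GT n a}.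
        \<phi> (add_entry P k j (-1)) * raising_coeff (add_entry P k j (-1)) k j * e P $ r)"
    proof (rule sum.cong[OF refl])
      fix j
      show "(\<Sum>P\<in>{P \<in> GT n a. add_entry P k j 1 \<in> GT n a}.
          \<phi> P * raising_coeff P k j * e (add_entry P k j 1) $ r) =
        (\<Sum>P\<in>{P \<in> GT n a. add_entry P k j (-1) \<in> GT n a}.
          \<phi> (add_entry P k j (-1)) * raising_coeff (add_entry P k j (-1)) k j * e P $ r)"
        by (rule sum.reindex_bij_witness[of _ "\<lambda>P. add_entry P k j (-1)" "\<lambda>P. add_entry P k j 1"]) auto
    qed
    also have "\<dots> = (\<Sum>P\<in>GT n a. \<Sum>j=1..k. if add_entry P k j (-1) \<in> GT n a
        then \<phi> (add_entry P k j (-1)) * raising_coeff (add_entry P k j (-1)) k j * e P $ r else 0)"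
      by (subst sum.swap) (simp add: sum.inter_filter finite_GT)
    also have "\<dots> = (\<Sum>R\<in>GT n a. (\<Sum>j=1..k. if add_entry R k j (-1) \<in> GT n a
        then raising_coeff (add_entry R k j (-1)) k j * \<phi> (add_entry R k j (-1)) else 0) * e R $ r)"
      by (rule sum.cong[OF refl]) (subst sum_distrib_right, rule sum.cong[OF refl], simp)
    finally show "(\<Sum>R\<in>GT n a. (\<Sum>j=1..k. if add_entry R k j (-1) \<in> GT n a
        then raising_coeff (add_entry R k j (-1)) k j * \<phi> (add_entry R k j (-1)) else 0) * e R $ r) = 0"
      by simp
  qed
  obtain P where P: "P \<in> GT n a" "\<phi> P \<noteq> 0"
  proof -
    have "\<exists>P\<in>GT n a. \<phi> P \<noteq> 0"
    proof (rule ccontr)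
      assume "\<not> (\<exists>P\<in>GT n a. \<phi> P \<noteq> 0)"
      then have "v = 0\<^sub>v N" using vc \<phi> by (intro eq_vecI) auto
      then show False using v0 by simp
    qed
    then show ?thesis using that by blast
  qed
  have highP: "P k j = P (Suc k) j" if "1 \<le> j" "j \<le> k" "k < n" for k j
    by (rule annihilated_imp_highest[of n a "\<lambda>R k j. raising_coeff (add_entry R k j (-1)) k j" \<phi>])
      (use kill P that raising_coeff_nonzero[of "add_entry _ _ _ (-1)"] in auto)
  have "P = H"
    by (rule highest_pattern_unique[OF P(1) H highP high])
  moreover have "eigenvalue i P = 2 powi int (a i)"
  proof -
    let ?t = "\<rho> (coroot n i 2)" and ?c = "2 powi int (a i) :: complex"
    have t: "?t \<in> carrier_mat N N" using i by (simp add: coroot_in_SL)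
    have tv: "?t *\<^sub>v v = ?c \<cdot>\<^sub>v v"
      using v coroot_in_SL[OF i, of 2] coroot_diagonal i weight_character_coroot[OF i, of 2]
      by (auto simp: weight_vector_def)
    have "\<phi> P * (eigenvalue i P - ?c) = 0"
    proof (rule e_independent[of "\<lambda>P. \<phi> P * (eigenvalue i P - ?c)", OF _ P(1)])
      fix r assume r: "r < N"
      have "(\<Sum>P\<in>GT n a. \<phi> P * (?t *\<^sub>v e P) $ r) = (?t *\<^sub>v v) $ r"
        by (rule mult_mat_vec_combination[symmetric]) (use t vc r \<phi> in auto)
      also have "\<dots> = ?c * (\<Sum>P\<in>GT n a. \<phi> P * e P $ r)"
        unfolding tv using r vc \<phi>[OF r] by simp
      finally show "(\<Sum>P\<in>GT n a. \<phi> P * (eigenvalue i P - ?c) * e P $ r) = 0"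
        by (simp add: eigenvalue_index[OF _ i r] sum_distrib_left sum_subtractf algebra_simps
          del: index_mult_mat_vec)
    qed
    then show ?thesis using P(2) by simp
  qed
  ultimately show ?thesis by simp
qed

text \<open>Induction on the level: a pattern in which no entry can be raised is the highest one.\<close>

lemma eigenvalue_eq:
  assumes hw: "has_highest_weight n N \<rho> a" and P: "P \<in> GT n a" and i: "1 \<le> i" "i < n"
  shows "eigenvalue i P = 2 powi pattern_weight P i"
  using P
proof (induction "nat (level n a P)" arbitrary: P rule: less_induct)
  case less
  show ?case
  proof (cases "\<exists>k j. 1 \<le> j \<and> j \<le> k \<and> k < n \<and> add_entry P k j 1 \<in> GT n a")
    case True
    then obtain k j where kj: "1 \<le> j" "j \<le> k" "k < n" and Q: "add_entry P k j 1 \<in> GT n a" by blast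
    have "level n a (add_entry P k j 1) = level n a P - 1"
      by (rule level_add_entry[OF less.prems Q kj])
    moreover have "level n a (add_entry P k j 1) \<ge> 0" by (rule level_nonneg[OF Q])
    ultimately have "eigenvalue i (add_entry P k j 1) = 2 powi pattern_weight (add_entry P k j 1) i"
      by (intro less.hyps Q) simp
    then show ?thesis
      unfolding eigenvalue_raise[OF less.prems Q kj i] pattern_weight_add_entry[OF kj(1,2) i(1)]
      by (simp add: power_int_add)
  next
    case False
    have high: "P k j = P (Suc k) j" if "1 \<le> j" "j \<le> k" "k < n" for k j
      using raisable_entry_exists[OF less.prems, of j k] False that by blast
    then show ?thesis
      using eigenvalue_highest[OF hw less.prems high i] highest_pattern_weight[OF less.prems high i] by simp
  qed
qed

text \<open>
  A highest weight vector of the dual representation is a functional that vanishes on the images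
  of all raising operators, and thus on all basis vectors but the one of the lowest pattern.
  Its weight is the negative of the weight of this pattern.
\<close>

lemma dual_highest_weight:
  assumes hw: "has_highest_weight n N \<rho> a" and dual: "has_highest_weight n N (dual_rep n \<rho>) b"
    and i: "1 \<le> i" "i < n"
  shows "b i = a (n - i)"
proof -
  obtain v where v: "weight_vector n N (dual_rep n \<rho>) (\<lambda>i. int (b i)) v"
    and fixed: "\<And>u. u \<in> carrier (SL n) \<Longrightarrow> upper_triangular u \<Longrightarrow> (\<forall>i<n. u $$ (i, i) = 1) \<Longrightarrow>
      dual_rep n \<rho> u *\<^sub>v v = v"
    using dual by (auto simp: has_highest_weight_def)
  have vc: "v \<in> carrier_vec N" and v0: "v \<noteq> 0\<^sub>v N" using v by (auto simp: weight_vector_def)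
  define \<phi> where "\<phi> = (\<lambda>P. v \<bullet> e P)"
  have sp: "v \<bullet> u = (\<Sum>r<N. v $ r * u $ r)" if "u \<in> carrier_vec N" for u
    using that by (simp add: scalar_prod_def lessThan_atLeast0)
  have kill: "(\<Sum>j=1..k. if add_entry P k j 1 \<in> GT n a then raising_coeff P k j * \<phi> (add_entry P k j 1) else 0) = 0"
    if P: "P \<in> GT n a" and k: "1 \<le> k" "k < n" for P k
  proof -
    let ?X = "root_vector_action n N \<rho> k (k + 1)"
    have ne: "k - 1 \<noteq> k" using k by simp
    have "0 = v \<bullet> (?X *\<^sub>v e P)"
    proof (rule functional_annihilates_action[symmetric])
      show "dual_rep n \<rho> (addrow_mat n s (k - 1) (k + 1 - 1)) *\<^sub>v v = v" for s
        using k ne by (intro fixed addrow_mat_in_SL) (auto simp: upper_triangular_def)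
    qed (use k vc P in auto)
    also have "\<dots> = (\<Sum>r<N. v $ r * (?X *\<^sub>v e P) $ r)"
      by (rule sp[OF mult_mat_vec_carrier[OF action_carrier e_carrier[OF P]]])
    also have "\<dots> = (\<Sum>r<N. \<Sum>j=1..k. if add_entry P k j 1 \<in> GT n a
        then raising_coeff P k j * (v $ r * e (add_entry P k j 1) $ r) else 0)"
      by (rule sum.cong[OF refl], subst raising_action_coords)
        (use k P in \<open>auto simp: sum_distrib_left mult_ac intro!: sum.cong\<close>)
    also have "\<dots> = (\<Sum>j=1..k. \<Sum>r<N. if add_entry P k j 1 \<in> GT n a
        then raising_coeff P k j * (v $ r * e (add_entry P k j 1) $ r) else 0)"
      by (rule sum.swap)
    also have "\<dots> = (\<Sum>j=1..k. if add_entry P k j 1 \<in> GT n a then raising_coeff P k j * \<phi> (add_entry P k j 1) else 0)"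
      by (rule sum.cong[OF refl]) (auto simp: \<phi>_def sp sum_distrib_left)
    finally show ?thesis by simp
  qed
  have "\<exists>P\<in>GT n a. \<phi> P \<noteq> 0"
  proof (rule ccontr)
    assume none: "\<not> (\<exists>P\<in>GT n a. \<phi> P \<noteq> 0)"
    have "v $ q = 0" if q: "q < N" for q
    proof -
      obtain c where c: "\<And>r. r < N \<Longrightarrow> unit_vec N q $ r = (\<Sum>P\<in>GT n a. c P * e P $ r)"
        using e_span[OF unit_vec_carrier] by blast
      have "v $ q = (\<Sum>r<N. v $ r * unit_vec N q $ r)"
        using q vc sp[of "unit_vec N q"] by simp
      also have "\<dots> = (\<Sum>r<N. \<Sum>P\<in>GT n a. c P * (v $ r * e P $ r))"
        by (rule sum.cong[OF refl]) (simp only: c lessThan_iff sum_distrib_left mult_ac)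
      also have "\<dots> = (\<Sum>P\<in>GT n a. \<Sum>r<N. c P * (v $ r * e P $ r))" by (rule sum.swap)
      also have "\<dots> = (\<Sum>P\<in>GT n a. c P * \<phi> P)"
        by (rule sum.cong[OF refl]) (simp add: \<phi>_def sp sum_distrib_left)
      also have "\<dots> = 0" using none by simp
      finally show ?thesis .
    qed
    then have "v = 0\<^sub>v N" using vc by (intro eq_vecI) auto
    then show False using v0 by simp
  qed
  then obtain Q where Q: "Q \<in> GT n a" "\<phi> Q \<noteq> 0" by blast
  have low: "Q k j = Q (Suc k) (Suc j)" if "1 \<le> j" "j \<le> k" "k < n" for k j
    by (rule annihilated_imp_lowest[of n a raising_coeff \<phi>])
      (use kill Q that raising_coeff_nonzero in auto)
  let ?t = "\<rho> (coroot n i 2)"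
  have t: "?t \<in> carrier_mat N N" using i by (simp add: coroot_in_SL)
  have "eigenvalue i Q * \<phi> Q = v \<bullet> (?t *\<^sub>v e Q)"
    using vc Q(1) by (simp add: eigenvalue[OF Q(1) i] \<phi>_def)
  also have "\<dots> = (transpose_mat ?t *\<^sub>v v) \<bullet> e Q"
    using transpose_vec_mult_scalar[OF t e_carrier[OF Q(1)] vc] by simp
  also have "transpose_mat ?t *\<^sub>v v = (1 / 2) powi int (b i) \<cdot>\<^sub>v v"
    using v coroot_in_SL[OF i, of "1 / 2"] coroot_diagonal[of n i "1 / 2"] coroot_inverse[OF i, of "1 / 2"]
      weight_character_coroot[OF i, of "1 / 2" "\<lambda>i. int (b i)"]
    by (auto simp: weight_vector_def dual_rep_def)
  also have "((1 / 2) powi int (b i) \<cdot>\<^sub>v v) \<bullet> e Q = (1 / 2) powi int (b i) * \<phi> Q"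
    using vc Q(1) by (simp add: \<phi>_def)
  finally have "eigenvalue i Q = (1 / 2) powi int (b i)" using Q(2) by simp
  then have "(2 :: complex) powi pattern_weight Q i = 2 powi (- int (b i))"
    unfolding eigenvalue_eq[OF hw Q(1) i] by (simp add: power_int_minus power_int_divide_distrib field_simps)
  then have "pattern_weight Q i = - int (b i)" by (rule powi_two_inject)
  then show ?thesis using lowest_pattern_weight[OF Q(1) low i] by simp
qed

end

section \<open>Invariance\<close>

lemma tensor_index_bounds:
  fixes r N M :: nat
  assumes "r < N * M"
  shows "r div M < N" "r mod M < M"
proof -
  have "M > 0" using assms by (cases M) auto
  then show "r div M < N" "r mod M < M" using assms by (auto simp: less_mult_imp_div_less)
qed

lemma index_tensor_vec:
  "v \<in> carrier_vec N \<Longrightarrow> w \<in> carrier_vec M \<Longrightarrow> r < N * M \<Longrightarrow> tensor_vec v w $ r = v $ (r div M) * w $ (r mod M)"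
  by (simp add: tensor_vec_def)

lemma tensor_vec_carrier: "v \<in> carrier_vec N \<Longrightarrow> w \<in> carrier_vec M \<Longrightarrow> tensor_vec v w \<in> carrier_vec (N * M)"
  by (auto simp: tensor_vec_def)

lemma tensor_mat_carrier:
  "A \<in> carrier_mat N N \<Longrightarrow> B \<in> carrier_mat M M \<Longrightarrow> tensor_mat A B \<in> carrier_mat (N * M) (N * M)"
  by (auto simp: tensor_mat_def)

lemma sum_tensor_index:
  fixes f :: "nat \<Rightarrow> nat \<Rightarrow> 'a :: comm_monoid_add"
  shows "(\<Sum>r<N * M. f (r div M) (r mod M)) = (\<Sum>i<N. \<Sum>j<M. f i j)"
proof -
  have "(\<Sum>i<N. \<Sum>j<M. f i j) = (\<Sum>(i, j)\<in>{..<N} \<times> {..<M}. f i j)"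
    by (rule sum.cartesian_product)
  also have "\<dots> = (\<Sum>r<N * M. f (r div M) (r mod M))"
  proof (rule sum.reindex_bij_witness[of _ "\<lambda>r. (r div M, r mod M)" "\<lambda>(i, j). i * M + j"])
    fix x assume x: "x \<in> {..<N} \<times> {..<M}"
    obtain i j where ij: "x = (i, j)" "i < N" "j < M" using x by auto
    have "i * M + j < Suc i * M" using ij by simp
    also have "\<dots> \<le> N * M" using ij by (intro mult_le_mono1) simp
    finally have "i * M + j < N * M" .
    then show "(case x of (i, j) \<Rightarrow> i * M + j) \<in> {..<N * M}" using ij by simp
  next
    fix r assume "r \<in> {..<N * M}"
    then show "(r div M, r mod M) \<in> {..<N} \<times> {..<M}"
      using tensor_index_bounds[of r N M] by simp
  qed (auto simp: div_mult_self3)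
  finally show ?thesis by simp
qed

lemma tensor_mat_mult_tensor_vec:
  assumes A: "A \<in> carrier_mat N N" and B: "B \<in> carrier_mat M M"
    and v: "v \<in> carrier_vec N" and w: "w \<in> carrier_vec M"
  shows "tensor_mat A B *\<^sub>v tensor_vec v w = tensor_vec (A *\<^sub>v v) (B *\<^sub>v w)"
proof (rule eq_vecI)
  fix r assume "r < dim_vec (tensor_vec (A *\<^sub>v v) (B *\<^sub>v w))"
  then have r: "r < N * M" using A B by (simp add: tensor_vec_def)
  note rb = tensor_index_bounds[OF r]
  have "(tensor_mat A B *\<^sub>v tensor_vec v w) $ r = (\<Sum>q<N * M. tensor_mat A B $$ (r, q) * tensor_vec v w $ q)"
    by (rule index_mult_mat_vec_sum[OF tensor_mat_carrier[OF A B] tensor_vec_carrier[OF v w] r])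
  also have "\<dots> = (\<Sum>q<N * M. (A $$ (r div M, q div M) * v $ (q div M)) * (B $$ (r mod M, q mod M) * w $ (q mod M)))"
    by (rule sum.cong[OF refl]) (use A B r v w in \<open>auto simp: tensor_mat_def index_tensor_vec\<close>)
  also have "\<dots> = (\<Sum>i<N. \<Sum>j<M. (A $$ (r div M, i) * v $ i) * (B $$ (r mod M, j) * w $ j))"
    by (rule sum_tensor_index)
  also have "\<dots> = (A *\<^sub>v v) $ (r div M) * (B *\<^sub>v w) $ (r mod M)"
    unfolding index_mult_mat_vec_sum[OF A v rb(1)] index_mult_mat_vec_sum[OF B w rb(2)] by (simp add: sum_product)
  also have "\<dots> = tensor_vec (A *\<^sub>v v) (B *\<^sub>v w) $ r"
    by (rule index_tensor_vec[symmetric]) (use A B v w r in auto)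
  finally show "(tensor_mat A B *\<^sub>v tensor_vec v w) $ r = tensor_vec (A *\<^sub>v v) (B *\<^sub>v w) $ r" .
qed (use A B v w in \<open>simp add: tensor_mat_def tensor_vec_def\<close>)

lemma tensor_mat_mult:
  assumes A: "A \<in> carrier_mat N N" "A' \<in> carrier_mat N N" and B: "B \<in> carrier_mat M M" "B' \<in> carrier_mat M M"
  shows "tensor_mat (A * A') (B * B') = tensor_mat A B * tensor_mat A' B'"
proof (rule eq_matI)
  fix r c assume "r < dim_row (tensor_mat A B * tensor_mat A' B')" "c < dim_col (tensor_mat A B * tensor_mat A' B')"
  then have rc: "r < N * M" "c < N * M" using A B by (auto simp: tensor_mat_def)
  note rb = tensor_index_bounds[OF rc(1)] and cb = tensor_index_bounds[OF rc(2)]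
  have "(tensor_mat A B * tensor_mat A' B') $$ (r, c) = (\<Sum>q<N * M. tensor_mat A B $$ (r, q) * tensor_mat A' B' $$ (q, c))"
    using A B rc by (simp add: tensor_mat_def scalar_prod_def lessThan_atLeast0)
  also have "\<dots> = (\<Sum>q<N * M. (A $$ (r div M, q div M) * A' $$ (q div M, c div M)) *
      (B $$ (r mod M, q mod M) * B' $$ (q mod M, c mod M)))"
    by (rule sum.cong[OF refl]) (use A B rc in \<open>auto simp: tensor_mat_def\<close>)
  also have "\<dots> = (\<Sum>i<N. \<Sum>j<M. (A $$ (r div M, i) * A' $$ (i, c div M)) * (B $$ (r mod M, j) * B' $$ (j, c mod M)))"
    by (rule sum_tensor_index)
  also have "\<dots> = (A * A') $$ (r div M, c div M) * (B * B') $$ (r mod M, c mod M)"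
    using A B rb cb by (simp add: scalar_prod_def lessThan_atLeast0 sum_product)
  also have "\<dots> = tensor_mat (A * A') (B * B') $$ (r, c)"
    using A B rc by (simp add: tensor_mat_def)
  finally show "tensor_mat (A * A') (B * B') $$ (r, c) = (tensor_mat A B * tensor_mat A' B') $$ (r, c)" by simp
qed (use A B in \<open>auto simp: tensor_mat_def\<close>)

lemma tensor_mat_one: "tensor_mat (1\<^sub>m N) (1\<^sub>m M) = 1\<^sub>m (N * M)"
proof (rule eq_matI)
  fix r c assume "r < dim_row (1\<^sub>m (N * M) :: complex mat)" "c < dim_col (1\<^sub>m (N * M) :: complex mat)"
  then have rc: "r < N * M" "c < N * M" by auto
  have "r = c" if "r div M = c div M" "r mod M = c mod M" using that by (metis div_mult_mod_eq)
  then show "tensor_mat (1\<^sub>m N) (1\<^sub>m M) $$ (r, c) = 1\<^sub>m (N * M) $$ (r, c)"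
    using rc tensor_index_bounds[OF rc(1)] tensor_index_bounds[OF rc(2)] by (auto simp: tensor_mat_def)
qed (auto simp: tensor_mat_def)

locale dual_GT_reps = V: GT_rep n N \<rho> a e + W: GT_rep n M \<sigma> b e'
  for n N M :: nat and \<rho> \<sigma> :: "complex mat \<Rightarrow> complex mat" and a b :: "nat \<Rightarrow> nat" and e e' +
  assumes dual_weights: "\<And>i. 1 \<le> i \<Longrightarrow> i < n \<Longrightarrow> b i = a (n - i)"
begin

abbreviation F :: "complex vec" where "F \<equiv> invariant_F n a N M e e'"

lemma dual_in_GT: "P \<in> GT n a \<Longrightarrow> dual_pattern n P \<in> GT n b"
  using dual_pattern_in_GT dual_weights by blast

lemma F_eq: "F = finsum_vec TYPE(complex) (N * M)
    (\<lambda>P. F_coeff n a P \<cdot>\<^sub>v tensor_vec (e P) (e' (dual_pattern n P))) (GT n a)"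
  by (simp add: invariant_F_def F_coeff_def)

lemma F_carrier: "F \<in> carrier_vec (N * M)"
  unfolding F_eq by (rule finsum_vec_closed) (auto simp: tensor_vec_carrier dual_in_GT)

lemma tensor_index_F:
  assumes A: "A \<in> carrier_mat N N" and B: "B \<in> carrier_mat M M" and r: "r < N * M"
  shows "(tensor_mat A B *\<^sub>v F) $ r =
    (\<Sum>P\<in>GT n a. F_coeff n a P * ((A *\<^sub>v e P) $ (r div M) * (B *\<^sub>v e' (dual_pattern n P)) $ (r mod M)))"
proof -
  let ?T = "\<lambda>P. tensor_vec (e P) (e' (dual_pattern n P))"
  have T: "?T P \<in> carrier_vec (N * M)" if "P \<in> GT n a" for P
    using that by (simp add: tensor_vec_carrier dual_in_GT)
  have F: "F $ q = (\<Sum>P\<in>GT n a. F_coeff n a P * ?T P $ q)" if q: "q < N * M" for q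
  proof -
    have "F $ q = (\<Sum>P\<in>GT n a. (F_coeff n a P \<cdot>\<^sub>v ?T P) $ q)"
      unfolding F_eq by (rule index_finsum_vec) (use V.finite_GT q T in auto)
    also have "\<dots> = (\<Sum>P\<in>GT n a. F_coeff n a P * ?T P $ q)"
      by (rule sum.cong[OF refl]) (use carrier_vecD[OF T] q in simp)
    finally show ?thesis .
  qed
  have "(tensor_mat A B *\<^sub>v F) $ r = (\<Sum>q<N * M. \<Sum>P\<in>GT n a. F_coeff n a P * (tensor_mat A B $$ (r, q) * ?T P $ q))"
    unfolding index_mult_mat_vec_sum[OF tensor_mat_carrier[OF A B] F_carrier r]
    by (rule sum.cong[OF refl]) (simp add: F sum_distrib_left mult.left_commute)
  also have "\<dots> = (\<Sum>P\<in>GT n a. \<Sum>q<N * M. F_coeff n a P * (tensor_mat A B $$ (r, q) * ?T P $ q))"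
    by (rule sum.swap)
  also have "\<dots> = (\<Sum>P\<in>GT n a. F_coeff n a P * (tensor_mat A B *\<^sub>v ?T P) $ r)"
    by (rule sum.cong[OF refl])
      (simp only: index_mult_mat_vec_sum[OF tensor_mat_carrier[OF A B] T r] sum_distrib_left)
  also have "\<dots> = (\<Sum>P\<in>GT n a. F_coeff n a P * ((A *\<^sub>v e P) $ (r div M) * (B *\<^sub>v e' (dual_pattern n P)) $ (r mod M)))"
  proof (rule sum.cong[OF refl])
    fix P assume P: "P \<in> GT n a"
    have eP: "e P \<in> carrier_vec N" "e' (dual_pattern n P) \<in> carrier_vec M"
      using P by (auto simp: dual_in_GT)
    show "F_coeff n a P * (tensor_mat A B *\<^sub>v ?T P) $ r =
        F_coeff n a P * ((A *\<^sub>v e P) $ (r div M) * (B *\<^sub>v e' (dual_pattern n P)) $ (r mod M))"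
      unfolding tensor_mat_mult_tensor_vec[OF A B eP]
        index_tensor_vec[OF mult_mat_vec_carrier[OF A eP(1)] mult_mat_vec_carrier[OF B eP(2)] r] by (rule refl)
  qed
  finally show ?thesis .
qed

text \<open>
  Coordinates of \<open>(A \<otimes> B) X\<^sub>k F\<close>, where \<open>X\<^sub>k\<close> acts on the tensor product by the Leibniz rule.
\<close>

lemma raising_kills_F:
  assumes k: "1 \<le> k" "k < n" and A: "A \<in> carrier_mat N N" and B: "B \<in> carrier_mat M M" and p: "p < N" and q: "q < M"
  shows "(\<Sum>P\<in>GT n a. F_coeff n a P *
    ((A *\<^sub>v (root_vector_action n N \<rho> k (k + 1) *\<^sub>v e P)) $ p * (B *\<^sub>v e' (dual_pattern n P)) $ q +
     (A *\<^sub>v e P) $ p * (B *\<^sub>v (root_vector_action n M \<sigma> k (k + 1) *\<^sub>v e' (dual_pattern n P))) $ q)) = 0"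
  by (rule trans[OF sum.cong[OF refl] paired_sum_vanishes[where c = 1 and f = "F_coeff n a" and C = raising_coeff
      and u = "\<lambda>P. (A *\<^sub>v e P) $ p" and w = "\<lambda>P. (B *\<^sub>v e' P) $ q", OF V.finite_GT dual_weights k F_coeff_raising]])
    (use k in \<open>simp_all only: V.raising_action[OF _ k A p] W.raising_action[OF dual_in_GT k B q] le_less_trans\<close>)

lemma lowering_kills_F:
  assumes k: "1 \<le> k" "k < n" and A: "A \<in> carrier_mat N N" and B: "B \<in> carrier_mat M M" and p: "p < N" and q: "q < M"
  shows "(\<Sum>P\<in>GT n a. F_coeff n a P *
    ((A *\<^sub>v (root_vector_action n N \<rho> (k + 1) k *\<^sub>v e P)) $ p * (B *\<^sub>v e' (dual_pattern n P)) $ q +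
     (A *\<^sub>v e P) $ p * (B *\<^sub>v (root_vector_action n M \<sigma> (k + 1) k *\<^sub>v e' (dual_pattern n P))) $ q)) = 0"
  by (rule trans[OF sum.cong[OF refl] paired_sum_vanishes[where c = "-1" and f = "F_coeff n a" and C = lowering_coeff
      and u = "\<lambda>P. (A *\<^sub>v e P) $ p" and w = "\<lambda>P. (B *\<^sub>v e' P) $ q", OF V.finite_GT dual_weights k F_coeff_lowering]])
    (use k in \<open>simp_all only: V.lowering_action[OF _ k A p] W.lowering_action[OF dual_in_GT k B q] le_less_trans\<close>)

text \<open>
  The derivative at \<open>s\<close> of \<open>g\<^sub>s F\<close>, where \<open>g\<^sub>s = 1 + s E\<^bsub>k,l\<^esub>\<close>, is the image of \<open>E\<^bsub>k,l\<^esub> F\<close> under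
  \<open>A \<otimes> B\<close> with \<open>A = \<rho>(g\<^sub>s)\<close> and \<open>B = \<sigma>(g\<^sub>s)\<close>.  So it is 0 everywhere.
\<close>

lemma F_fixed_by_root_subgroup:
  assumes kl: "1 \<le> k" "k \<le> n" "1 \<le> l" "l \<le> n" "k \<noteq> l"
    and kills: "\<And>A B p q. A \<in> carrier_mat N N \<Longrightarrow> B \<in> carrier_mat M M \<Longrightarrow> p < N \<Longrightarrow> q < M \<Longrightarrow>
      (\<Sum>P\<in>GT n a. F_coeff n a P *
      ((A *\<^sub>v (root_vector_action n N \<rho> k l *\<^sub>v e P)) $ p * (B *\<^sub>v e' (dual_pattern n P)) $ q +
       (A *\<^sub>v e P) $ p * (B *\<^sub>v (root_vector_action n M \<sigma> k l *\<^sub>v e' (dual_pattern n P))) $ q)) = 0"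
  shows "tensor_rep \<rho> \<sigma> (addrow_mat n s (k - 1) (l - 1)) *\<^sub>v F = F"
proof (rule eq_vecI)
  let ?x = "\<lambda>s. addrow_mat n s (k - 1) (l - 1)"
  have ne: "k - 1 \<noteq> l - 1" using kl by auto
  have x: "\<rho> (?x s) \<in> carrier_mat N N" "\<sigma> (?x s) \<in> carrier_mat M M" for s
    by (rule V.rho_carrier[OF addrow_mat_in_SL[OF ne]], rule W.rho_carrier[OF addrow_mat_in_SL[OF ne]])
  fix r assume "r < dim_vec F"
  then have r: "r < N * M" using F_carrier by simp
  let ?p = "r div M" and ?q = "r mod M"
  note pq = tensor_index_bounds[OF r]
  define h where "h = (\<lambda>s. \<Sum>P\<in>GT n a. F_coeff n a P *
    ((\<rho> (?x s) *\<^sub>v e P) $ ?p * (\<sigma> (?x s) *\<^sub>v e' (dual_pattern n P)) $ ?q))"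
  have h: "(tensor_rep \<rho> \<sigma> (?x s) *\<^sub>v F) $ r = h s" for s
    unfolding tensor_rep_def h_def by (rule tensor_index_F[OF x r])
  have "(h has_field_derivative 0) (at s)" for s
  proof -
    have "(h has_field_derivative (\<Sum>P\<in>GT n a. F_coeff n a P *
        ((\<rho> (?x s) *\<^sub>v (root_vector_action n N \<rho> k l *\<^sub>v e P)) $ ?p * (\<sigma> (?x s) *\<^sub>v e' (dual_pattern n P)) $ ?q +
         (\<sigma> (?x s) *\<^sub>v (root_vector_action n M \<sigma> k l *\<^sub>v e' (dual_pattern n P))) $ ?q * (\<rho> (?x s) *\<^sub>v e P) $ ?p)))
        (at s)"
      unfolding h_def
      by (intro DERIV_sum DERIV_cmult DERIV_mult V.action_DERIV[OF kl pq(1)] W.action_DERIV[OF kl pq(2)])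
        (auto simp: dual_in_GT)
    then show ?thesis
      using kills[OF x pq, of s] by (simp only: mult.commute)
  qed
  then have "h s = h 0"
    using has_field_derivative_zero_constant[of UNIV h] by (metis UNIV_I convex_UNIV)
  also have "h 0 = (tensor_rep \<rho> \<sigma> (1\<^sub>m n) *\<^sub>v F) $ r"
    unfolding h[symmetric] addrow_mat_zero ..
  also have "\<dots> = F $ r"
    unfolding tensor_rep_def V.rho_one W.rho_one tensor_mat_one using F_carrier by simp
  finally show "(tensor_rep \<rho> \<sigma> (?x s) *\<^sub>v F) $ r = F $ r"
    using h by simp
next
  have ne: "k - 1 \<noteq> l - 1" using kl by auto
  show "dim_vec (tensor_rep \<rho> \<sigma> (addrow_mat n s (k - 1) (l - 1)) *\<^sub>v F) = dim_vec F"
    using carrier_vecD[OF F_carrier]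
      carrier_matD(1)[OF tensor_mat_carrier[OF V.rho_carrier[OF addrow_mat_in_SL[OF ne]] W.rho_carrier[OF addrow_mat_in_SL[OF ne]]], of s s]
    by (simp add: tensor_rep_def del: One_nat_def)
qed

lemma F_invariant: "invariant_vector n (N * M) (tensor_rep \<rho> \<sigma>) F"
  unfolding invariant_vector_def
proof (intro conjI ballI)
  fix g assume g: "g \<in> carrier (SL n)"
  show "tensor_rep \<rho> \<sigma> g *\<^sub>v F = F"
  proof (rule SL_induct_simple[where H = "\<lambda>g. tensor_rep \<rho> \<sigma> g *\<^sub>v F = F" and n = n])
    show "tensor_rep \<rho> \<sigma> (1\<^sub>m n) *\<^sub>v F = F"
      unfolding tensor_rep_def V.rho_one W.rho_one tensor_mat_one using F_carrier by simp
  next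
    fix A B :: "complex mat"
    assume "A \<in> carrier_mat n n" "B \<in> carrier_mat n n" "det A = 1" "det B = 1"
    then have AB: "A \<in> carrier (SL n)" "B \<in> carrier (SL n)" by (auto simp: mem_SL)
    assume fixed: "tensor_rep \<rho> \<sigma> A *\<^sub>v F = F" "tensor_rep \<rho> \<sigma> B *\<^sub>v F = F"
    have c: "tensor_rep \<rho> \<sigma> C \<in> carrier_mat (N * M) (N * M)" if "C \<in> carrier (SL n)" for C
      using that by (simp add: tensor_rep_def tensor_mat_carrier)
    have "tensor_rep \<rho> \<sigma> (A * B) = tensor_rep \<rho> \<sigma> A * tensor_rep \<rho> \<sigma> B"
      using AB by (simp add: tensor_rep_def V.rho_mult W.rho_mult tensor_mat_mult[of _ N _ _ M])
    then show "tensor_rep \<rho> \<sigma> (A * B) *\<^sub>v F = F"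
      using fixed assoc_mult_mat_vec[OF c[OF AB(1)] c[OF AB(2)] F_carrier] by simp
  next
    fix s k assume k: "Suc k < n"
    show "tensor_rep \<rho> \<sigma> (addrow_mat n s k (Suc k)) *\<^sub>v F = F"
      using F_fixed_by_root_subgroup[of "Suc k" "Suc k + 1" s] raising_kills_F[of "Suc k"] k by simp
    show "tensor_rep \<rho> \<sigma> (addrow_mat n s (Suc k) k) *\<^sub>v F = F"
      using F_fixed_by_root_subgroup[of "Suc k + 1" "Suc k" s] lowering_kills_F[of "Suc k"] k by simp
  qed (use g in \<open>auto simp: mem_SL\<close>)
qed (rule F_carrier)

end

theorem theoremA1:
  fixes n N M :: nat
    and a b :: "nat \<Rightarrow> nat"
    and \<rho> \<sigma> :: "complex mat \<Rightarrow> complex mat"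
    and e e' :: "pattern \<Rightarrow> complex vec"
  assumes "n \<ge> 2"
    and "irreducible_of_highest_weight n N \<rho> a"
    and "has_highest_weight n N (dual_rep n \<rho>) b"
    and "irreducible_of_highest_weight n M \<sigma> b"
    and "GT_basis n N \<rho> a e"
    and "GT_basis n M \<sigma> b e'"
  shows "invariant_vector n (N * M) (tensor_rep \<rho> \<sigma>) (invariant_F n a N M e e')"
proof -
  have hw: "rational_representation n N \<rho>" "rational_representation n M \<sigma>" "has_highest_weight n N \<rho> a"
    using assms(2,4) by (auto simp: irreducible_of_highest_weight_def irreducible_representation_def)
  interpret V: GT_rep n N \<rho> a e by unfold_locales (use hw assms in auto)
  interpret dual_GT_reps n N M \<rho> \<sigma> a b e e'
    by unfold_locales (use hw assms V.dual_highest_weight in auto)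
  show ?thesis by (rule F_invariant)
qed

end
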